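(* Let $\{\mathbf e_n,\mathbf e_n^*\}_{n=1}^\infty$ be a seminormalized, complete biorthogonal system in the Banach space $\mathbb X$, with upper super-democracy sequences $D$ and $D^*$, and put $\overline T_N=\overline T_N(D,D^* )$ and $S_N=S_N(D,D^* )$. Then for every $N=1,2,\ldots$ $$K_N\le \overline T_N,\qquad \mathbf L_N,\ \mathbf L_N^*\ \le\ 1+3\overline T_N,\qquad \widetilde{\mathbf L}_N,\ \widetilde{\mathbf L}_N^*\ \le\ 1+2\overline T_N .$$ If, additionally, $D$ is concave, then $S_N\le \overline T_N$ and $$K_N\le S_N,\qquad \mathbf L_N\le 1+3S_N,\qquad \widetilde{\mathbf L}_N\le 1+2S_N .$$ Respectively, if additionally $D^*$ is concave, then $S_N\le\overline T_N$ and $K_N^*\le S_N$, $\mathbf L_N^*\le 1+3S_N$, $\widetilde{\mathbf L}_N^*\le 1+2S_N$. Finally, these estimates are best possible, in the sense that there exist a Banach space $\mathbb X$ and a seminormalized, complete biorthogonal system $\{\mathbf e_n,\mathbf e_n^*\}_{n=1}^\infty$ in $\mathbb X$ for which equality holds in all of them.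
   Context: Setting: $(\mathbb X,\|\cdot\|)$ is a separable infinite-dimensional Banach space over $\mathbb K=\mathbb R$ or $\mathbb C$ with dual $(\mathbb X^*,\|\cdot\|_* )$. A system $\{\mathbf e_n,\mathbf e_n^*\}_{n=1}^\infty\subset \mathbb X\times\mathbb X^*$ is biorthogonal if $\mathbf e_n^*(\mathbf e_m)=\delta_{n,m}$; seminormalized if there are $A,B\in(0,\infty)$ with $A\le\|\mathbf e_n\|,\|\mathbf e_n^*\|_*\le B$ for all $n$; complete if the closed linear span of $\{\mathbf e_n\}$ is $\mathbb X$. Write $\mathcal B=\{\mathbf e_n\}$, $\mathcal B^*=\{\mathbf e_n^*\}$. Greedy operators: for $x\in\mathbb X$, a set $A\subset\mathbb N$ with $|A|=N$ is a greedy set for $x$ of order $N$ if $\min_{n\in A}|\mathbf e_n^*(x)|\ge\max_{n\notin A}|\mathbf e_n^*(x)|$. A greedy operator of order $N$ is any map $G_N:\mathbb X\to\mathbb X$ of the form $G_Nx=\sum_{n\in A_x}\mathbf e_n^*(x)\mathbf e_n$ with $A_x$ a greedy set for $x$ of order $N$; $\mathcal G_N$ is the set of all of them. Errors: $\sigma_N(x)=\inf\{\|x-\sum_{n\in A}c_n\mathbf e_n\|: c_n\in\mathbb K,\ |A|\le N\}$ and $\widetilde\sigma_N(x)=\inf\{\|x-\sum_{n\in A}\mathbf e_n^*(x)\mathbf e_n\|: |A|\le N\}$. $\mathbf L_N$ (resp. $\widetilde{\mathbf L}_N$) is the smallest constant with $\|x-G_Nx\|\le\mathbf L_N\sigma_N(x)$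 (resp. $\|x-G_Nx\|\le\widetilde{\mathbf L}_N\widetilde\sigma_N(x)$) for all $x\in\mathbb X$, $G_N\in\mathcal G_N$. Democracy: for finite $A\subset\mathbb N$ and $\varepsilon=\{\varepsilon_j\}\subset\mathbb K$ with $|\varepsilon_j|=1$ for all $j$, $\mathbf 1_{\varepsilon A}=\sum_{j\in A}\varepsilon_j\mathbf e_j$, $\mathbf 1^*_{\varepsilon A}=\sum_{j\in A}\varepsilon_j\mathbf e_j^*$; $D(N)=\sup_{|A|=N,\varepsilon}\|\mathbf 1_{\varepsilon A}\|$, $D^*(N)=\sup_{|A|=N,\varepsilon}\|\mathbf 1^*_{\varepsilon A}\|_*$. $K_N=\sup\{\|P_A\|:|A|\le N\}$, where $P_Ax=\sum_{n\in A}\mathbf e_n^*(x)\mathbf e_n$. Starred quantities $K_N^*,\mathbf L_N^*,\widetilde{\mathbf L}_N^*$ are the same quantities for the system $\mathcal B^*$ in $\widehat{\mathbb X}:=\overline{\mathrm{span}}\{\mathbf e_n^*\}\subset\mathbb X^*$ (with norm $\|\cdot\|_*$), whose biorthogonal functionals are $f\mapsto f(\mathbf e_n)$. For positive non-decreasing sequences $\eta_1,\eta_2$, with $\Delta\eta(j)=\eta(j)-\eta(j-1)$ and $\eta(0)=0$: $S_N(\eta_1,\eta_2)=\sum_{j=1}^N\Delta\eta_1(j)\Delta\eta_2(j)$, $T_N(\eta_1,\eta_2)=\sum_{j=1}^N\frac{\eta_1(j)}j\Delta\eta_2(j)$, $\overline T_N(\eta_1,\eta_2)=\min\{T_N(\eta_1,\eta_2),T_N(\eta_2,\eta_1)\}$.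 A positive non-decreasing $\eta$ is concave if $\Delta\eta(j)\le\Delta\eta(j-1)$ for all $j\ge2$. *)

theory Defs
  imports "HOL-Analysis.Analysis"
begin

text \<open>
  The scalar field is a type \<open>'k\<close> of sort \<open>{real_normed_field, euclidean_space}\<close>.
  By the Gelfand-Mazur theorem, such a type is isometrically isomorphic to the reals or to the
  complex numbers, and both types are instances.  The space is a type of class \<open>banach\<close>,
  with scalar multiplication \<open>smul\<close> over \<open>'k\<close> extending \<open>(*\<^sub>R)\<close>.
\<close>

locale separable_infinite_dim_banach = vector_space smul
  for smul :: "'k::{real_normed_field,euclidean_space} \<Rightarrow> 'a::banach \<Rightarrow> 'a" +
  assumes scale_of_real: "smul (of_real r) x = r *\<^sub>R x"
    and norm_scale: "norm (smul c x) = norm c * norm x"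
    and separable: "separable_space (euclidean :: 'a topology)"
    and infinite_dim: "\<nexists>B. finite B \<and> module.span smul B = UNIV"

text \<open>
  The dual space consists of the \<open>'k\<close>-linear elements of \<open>'a \<Rightarrow>\<^sub>L 'k\<close> (whose elements
  are only required to be real-linear), with the operator norm of that type.
  The systems are indexed by the type \<open>nat\<close>, hence from \<open>0\<close>; the sequences
  \<open>D(N)\<close>, \<open>K\<^sub>N\<close>, \<open>\<dots>\<close> keep their natural index \<open>N\<close>.
\<close>

locale biorthogonal_system = separable_infinite_dim_banach smul
  for smul :: "'k::{real_normed_field,euclidean_space} \<Rightarrow> 'a::banach \<Rightarrow> 'a" +
  fixes e :: "nat \<Rightarrow> 'a"
    and es :: "nat \<Rightarrow> 'a \<Rightarrow>\<^sub>L 'k"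
  assumes es_scale: "blinfun_apply (es n) (smul c x) = c * blinfun_apply (es n) x"
    and biorthogonal: "blinfun_apply (es n) (e m) = (if n = m then 1 else 0)"

locale seminormalized_complete_biorthogonal_system = biorthogonal_system +
  assumes seminormalized:
      "\<exists>A B::real. 0 < A \<and> 0 < B \<and>
         (\<forall>n. A \<le> norm (e n) \<and> norm (e n) \<le> B \<and> A \<le> norm (es n) \<and> norm (es n) \<le> B)"
    and complete_system: "closure (module.span smul (range e)) = UNIV"

definition dual_scale ::
    "'k::real_normed_field \<Rightarrow> ('a::real_normed_vector \<Rightarrow>\<^sub>L 'k) \<Rightarrow> ('a \<Rightarrow>\<^sub>L 'k)" where
  "dual_scale c f = blinfun_mult_right c o\<^sub>L f"

definition dual_closed_span :: "(nat \<Rightarrow> 'a::real_normed_vector \<Rightarrow>\<^sub>L 'k::real_normed_field) \<Rightarrow> ('a \<Rightarrow>\<^sub>L 'k) set" where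
  "dual_closed_span es = closure (module.span dual_scale (range es))"

text \<open>
  The following notions are defined for a system \<open>e\<close> in a normed space \<open>V\<close>, given as a
  subspace of a normed type, with coordinate functionals \<open>f\<close> on \<open>V\<close>, so that they apply
  both to \<open>(e\<^sub>n, e\<^sub>n\<^sup>*)\<close> in the whole space and to the dual system in the closed span
  of the \<open>e\<^sub>n\<^sup>*\<close>.
\<close>

definition coord_proj ::
    "('k \<Rightarrow> 'v \<Rightarrow> 'v::real_normed_vector) \<Rightarrow> (nat \<Rightarrow> 'v) \<Rightarrow> (nat \<Rightarrow> 'v \<Rightarrow> 'k) \<Rightarrow> nat set \<Rightarrow> 'v \<Rightarrow> 'v" where
  "coord_proj smul e f A x = (\<Sum>n\<in>A. smul (f n x) (e n))"

definition greedy_set ::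
    "(nat \<Rightarrow> 'v \<Rightarrow> 'k::real_normed_field) \<Rightarrow> 'v \<Rightarrow> nat \<Rightarrow> nat set \<Rightarrow> bool" where
  "greedy_set f x N A \<longleftrightarrow>
     finite A \<and> card A = N \<and> (\<forall>n\<in>A. \<forall>m. m \<notin> A \<longrightarrow> norm (f m x) \<le> norm (f n x))"

definition greedy_operators ::
    "'v set \<Rightarrow> ('k::real_normed_field \<Rightarrow> 'v \<Rightarrow> 'v::real_normed_vector) \<Rightarrow> (nat \<Rightarrow> 'v) \<Rightarrow> (nat \<Rightarrow> 'v \<Rightarrow> 'k)
      \<Rightarrow> nat \<Rightarrow> ('v \<Rightarrow> 'v) set" where
  "greedy_operators V smul e f N =
     {G. \<forall>x\<in>V. \<exists>A. greedy_set f x N A \<and> G x = coord_proj smul e f A x}"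

definition best_error ::
    "('k \<Rightarrow> 'v \<Rightarrow> 'v::real_normed_vector) \<Rightarrow> (nat \<Rightarrow> 'v) \<Rightarrow> nat \<Rightarrow> 'v \<Rightarrow> real" where
  "best_error smul e N x =
     Inf {norm (x - (\<Sum>n\<in>A. smul (c n) (e n))) | c A. finite A \<and> card A \<le> N}"

definition best_proj_error ::
    "('k \<Rightarrow> 'v \<Rightarrow> 'v::real_normed_vector) \<Rightarrow> (nat \<Rightarrow> 'v) \<Rightarrow> (nat \<Rightarrow> 'v \<Rightarrow> 'k) \<Rightarrow> nat \<Rightarrow> 'v \<Rightarrow> real" where
  "best_proj_error smul e f N x =
     Inf {norm (x - coord_proj smul e f A x) | A. finite A \<and> card A \<le> N}"

text \<open>
  The constants below are extended reals, so that \<open>\<infinity>\<close> is their value when no finite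
  constant exists.
\<close>

definition lebesgue_const ::
    "'v set \<Rightarrow> ('k::real_normed_field \<Rightarrow> 'v \<Rightarrow> 'v::real_normed_vector) \<Rightarrow> (nat \<Rightarrow> 'v) \<Rightarrow> (nat \<Rightarrow> 'v \<Rightarrow> 'k)
      \<Rightarrow> nat \<Rightarrow> ereal" where
  "lebesgue_const V smul e f N =
     Inf {ereal C | C. \<forall>x\<in>V. \<forall>G\<in>greedy_operators V smul e f N.
                         norm (x - G x) \<le> C * best_error smul e N x}"

definition proj_lebesgue_const ::
    "'v set \<Rightarrow> ('k::real_normed_field \<Rightarrow> 'v \<Rightarrow> 'v::real_normed_vector) \<Rightarrow> (nat \<Rightarrow> 'v) \<Rightarrow> (nat \<Rightarrow> 'v \<Rightarrow> 'k)
      \<Rightarrow> nat \<Rightarrow> ereal" where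
  "proj_lebesgue_const V smul e f N =
     Inf {ereal C | C. \<forall>x\<in>V. \<forall>G\<in>greedy_operators V smul e f N.
                         norm (x - G x) \<le> C * best_proj_error smul e f N x}"

text \<open>
  The inner supremum is the operator norm of \<open>P\<^sub>A\<close> on \<open>V\<close>, in the form in which
  \<open>onorm\<close> is defined (with \<open>0 / 0 = 0\<close>).
\<close>

definition proj_const ::
    "'v set \<Rightarrow> ('k::real_normed_field \<Rightarrow> 'v \<Rightarrow> 'v::real_normed_vector) \<Rightarrow> (nat \<Rightarrow> 'v) \<Rightarrow> (nat \<Rightarrow> 'v \<Rightarrow> 'k)
      \<Rightarrow> nat \<Rightarrow> ereal" where
  "proj_const V smul e f N =
     (SUP A\<in>{A. finite A \<and> card A \<le> N}. SUP x\<in>V. ereal (norm (coord_proj smul e f A x) / norm x))"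

text \<open>
  For a seminormalized system the supremum is over a bounded set of reals
  (by \<open>N\<close> times the upper bound of the norms).
\<close>

definition super_democracy ::
    "('k::real_normed_field \<Rightarrow> 'v \<Rightarrow> 'v::real_normed_vector) \<Rightarrow> (nat \<Rightarrow> 'v) \<Rightarrow> nat \<Rightarrow> real" where
  "super_democracy smul e N =
     Sup {norm (\<Sum>j\<in>A. smul (\<epsilon> j) (e j)) | A \<epsilon>. finite A \<and> card A = N \<and> (\<forall>j. norm (\<epsilon> j) = 1)}"

abbreviation K_const where
  "K_const smul e es \<equiv> proj_const UNIV smul e (\<lambda>n. blinfun_apply (es n))"

abbreviation L_const where
  "L_const smul e es \<equiv> lebesgue_const UNIV smul e (\<lambda>n. blinfun_apply (es n))"

abbreviation Lt_const where
  "Lt_const smul e es \<equiv> proj_lebesgue_const UNIV smul e (\<lambda>n. blinfun_apply (es n))"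

abbreviation K_star where
  "K_star e es \<equiv> proj_const (dual_closed_span es) dual_scale es (\<lambda>n g. blinfun_apply g (e n))"

abbreviation L_star where
  "L_star e es \<equiv> lebesgue_const (dual_closed_span es) dual_scale es (\<lambda>n g. blinfun_apply g (e n))"

abbreviation Lt_star where
  "Lt_star e es \<equiv> proj_lebesgue_const (dual_closed_span es) dual_scale es (\<lambda>n g. blinfun_apply g (e n))"

abbreviation D_star where
  "D_star es \<equiv> super_democracy dual_scale es"

text \<open>Sequences are indexed from \<open>1\<close>, with the convention \<open>\<eta>(0) = 0\<close>.\<close>

definition Delta :: "(nat \<Rightarrow> real) \<Rightarrow> nat \<Rightarrow> real" where
  "Delta \<eta> j = \<eta> j - (if j = 1 then 0 else \<eta> (j - 1))"

definition S_sum :: "(nat \<Rightarrow> real) \<Rightarrow> (nat \<Rightarrow> real) \<Rightarrow> nat \<Rightarrow> real" where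
  "S_sum \<eta>1 \<eta>2 N = (\<Sum>j=1..N. Delta \<eta>1 j * Delta \<eta>2 j)"

definition T_sum :: "(nat \<Rightarrow> real) \<Rightarrow> (nat \<Rightarrow> real) \<Rightarrow> nat \<Rightarrow> real" where
  "T_sum \<eta>1 \<eta>2 N = (\<Sum>j=1..N. \<eta>1 j / real j * Delta \<eta>2 j)"

definition T_bar :: "(nat \<Rightarrow> real) \<Rightarrow> (nat \<Rightarrow> real) \<Rightarrow> nat \<Rightarrow> real" where
  "T_bar \<eta>1 \<eta>2 N = min (T_sum \<eta>1 \<eta>2 N) (T_sum \<eta>2 \<eta>1 N)"

definition concave_seq :: "(nat \<Rightarrow> real) \<Rightarrow> bool" where
  "concave_seq \<eta> \<longleftrightarrow> (\<forall>j\<ge>2. Delta \<eta> j \<le> Delta \<eta> (j - 1))"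

text \<open>
  The space \<open>c\<close> with the supremum norm, as a closed subspace of the bounded sequences.
  HOL cannot quantify existentially over types, so the optimality of the estimates is
  stated for systems in this space.
\<close>

typedef (overloaded) 'k conv_seq = "{s :: nat \<Rightarrow>\<^sub>C 'k::real_normed_vector. convergent (apply_bcontfun s)}"
  morphisms seq_of Conv_seq
proof
  show "0 \<in> {s :: nat \<Rightarrow>\<^sub>C 'k. convergent (apply_bcontfun s)}"
    by (simp add: zero_bcontfun.rep_eq convergent_const)
qed

setup_lifting type_definition_conv_seq

instantiation conv_seq :: (real_normed_vector) real_vector
begin

lift_definition zero_conv_seq :: "'a conv_seq" is 0
  by (simp add: zero_bcontfun.rep_eq convergent_const)

lift_definition plus_conv_seq :: "'a conv_seq \<Rightarrow> 'a conv_seq \<Rightarrow> 'a conv_seq" is "(+)"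
  by (simp add: convergent_add)

lift_definition minus_conv_seq :: "'a conv_seq \<Rightarrow> 'a conv_seq \<Rightarrow> 'a conv_seq" is "(-)"
  by (simp add: convergent_diff)

lift_definition uminus_conv_seq :: "'a conv_seq \<Rightarrow> 'a conv_seq" is "uminus"
  by (simp add: convergent_minus_iff[symmetric])

lift_definition scaleR_conv_seq :: "real \<Rightarrow> 'a conv_seq \<Rightarrow> 'a conv_seq" is "(*\<^sub>R)"
  by (auto simp: convergent_def intro: tendsto_scaleR[OF tendsto_const])

instance
proof
  fix x y z :: "'a conv_seq" and a b :: real
  show "x + y + z = x + (y + z)" by transfer simp
  show "x + y = y + x" by transfer simp
  show "0 + x = x" by transfer simp
  show "- x + x = 0" by transfer simp
  show "x - y = x + - y" by transfer simp
  show "a *\<^sub>R (x + y) = a *\<^sub>R x + a *\<^sub>R y" by transfer (simp add: scaleR_add_right)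
  show "(a + b) *\<^sub>R x = a *\<^sub>R x + b *\<^sub>R x" by transfer (simp add: scaleR_add_left)
  show "a *\<^sub>R b *\<^sub>R x = (a * b) *\<^sub>R x" by transfer simp
  show "1 *\<^sub>R x = x" by transfer simp
qed

end

instantiation conv_seq :: (real_normed_vector) real_normed_vector
begin

lift_definition norm_conv_seq :: "'a conv_seq \<Rightarrow> real" is norm .

definition dist_conv_seq :: "'a conv_seq \<Rightarrow> 'a conv_seq \<Rightarrow> real" where
  "dist_conv_seq x y = norm (x - y)"

definition sgn_conv_seq :: "'a conv_seq \<Rightarrow> 'a conv_seq" where
  "sgn_conv_seq x = x /\<^sub>R norm x"

definition uniformity_conv_seq :: "('a conv_seq \<times> 'a conv_seq) filter" where
  "uniformity_conv_seq = (INF e\<in>{0 <..}. principal {(x, y). dist x y < e})"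

definition open_conv_seq :: "'a conv_seq set \<Rightarrow> bool" where
  "open_conv_seq U = (\<forall>x\<in>U. eventually (\<lambda>(x', y). x' = x \<longrightarrow> y \<in> U) uniformity)"

instance
proof
  fix x y :: "'a conv_seq" and a :: real
  show "norm x = 0 \<longleftrightarrow> x = 0" by transfer simp
  show "norm (x + y) \<le> norm x + norm y" by transfer (rule norm_triangle_ineq)
  show "norm (a *\<^sub>R x) = \<bar>a\<bar> * norm x" by transfer simp
  show "dist x y = norm (x - y)" by (rule dist_conv_seq_def)
  show "sgn x = x /\<^sub>R norm x" by (rule sgn_conv_seq_def)
  show "uniformity = (INF e\<in>{0 <..}. principal {(x, y :: 'a conv_seq). dist x y < e})"
    by (rule uniformity_conv_seq_def)
  show "open U = (\<forall>x\<in>U. \<forall>\<^sub>F (x', y) in uniformity. x' = x \<longrightarrow> y \<in> U)" for U :: "'a conv_seq set"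
    by (rule open_conv_seq_def)
qed

end

instance conv_seq :: (banach) banach
proof
  fix X :: "nat \<Rightarrow> 'a conv_seq"
  have dist_eq: "dist x y = dist (seq_of x) (seq_of y)" for x y :: "'a conv_seq"
    by (simp add: dist_norm norm_conv_seq.rep_eq minus_conv_seq.rep_eq)
  assume "Cauchy X"
  then have "Cauchy (\<lambda>n. seq_of (X n))"
    unfolding Cauchy_def dist_eq .
  then obtain g where "uniform_limit UNIV (\<lambda>n. apply_bcontfun (seq_of (X n))) g sequentially"
    using uniformly_convergent_eq_cauchy[of "\<lambda>_. True" "\<lambda>n. apply_bcontfun (seq_of (X n))"]
    unfolding Cauchy_def uniform_limit_sequentially_iff
    by (metis dist_fun_lt_imp_dist_val_lt)
  then obtain s where s: "(\<lambda>n. seq_of (X n)) \<longlonglongrightarrow> s"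
    using uniform_limit_bcontfunE[OF _ sequentially_bot] by metis
  have "Cauchy (apply_bcontfun s)"
  proof (rule metric_CauchyI)
    fix \<epsilon> :: real
    assume "0 < \<epsilon>"
    then obtain n where n: "dist (seq_of (X n)) s < \<epsilon> / 3"
      using metric_LIMSEQ_D[OF s, of "\<epsilon> / 3"] by (meson divide_pos_pos order_refl zero_less_numeral)
    have "Cauchy (apply_bcontfun (seq_of (X n)))"
      using seq_of[of "X n"] convergent_Cauchy by blast
    then obtain M where M: "\<And>i j. i \<ge> M \<Longrightarrow> j \<ge> M \<Longrightarrow> dist (seq_of (X n) i) (seq_of (X n) j) < \<epsilon> / 3"
      using metric_CauchyD[of "apply_bcontfun (seq_of (X n))" "\<epsilon> / 3"] \<open>0 < \<epsilon>\<close>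
      by (meson divide_pos_pos zero_less_numeral)
    have near: "dist (seq_of (X n) i) (s i) < \<epsilon> / 3" for i
      using dist_bounded[of "seq_of (X n)" i s] n by linarith
    show "\<exists>M. \<forall>i\<ge>M. \<forall>j\<ge>M. dist (s i) (s j) < \<epsilon>"
    proof (intro exI allI impI)
      fix i j
      assume "i \<ge> M" "j \<ge> M"
      then show "dist (s i) (s j) < \<epsilon>"
        using M[of i j] near[of i] near[of j]
          dist_triangle2[of "s i" "s j" "seq_of (X n) i"]
          dist_triangle[of "seq_of (X n) i" "s j" "seq_of (X n) j"]
          dist_commute[of "s i" "seq_of (X n) i"] dist_commute[of "s j" "seq_of (X n) i"]
        by linarith
    qed
  qed
  then have "convergent (apply_bcontfun s)"
    by (rule Cauchy_convergent)
  then have "seq_of (Conv_seq s) = s"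
    by (simp add: Conv_seq_inverse)
  with s have "X \<longlonglongrightarrow> Conv_seq s"
    unfolding lim_sequentially dist_eq by simp
  then show "convergent X"
    by (auto simp: convergent_def)
qed

end

theory Submission
  imports Defs
begin

text \<open>
  Enumerate a finite set \<open>A\<close> so that the moduli \<open>\<alpha>\<^sub>j\<close> of the coefficients of \<open>x\<close> on \<open>A\<close> decrease.
  Abel summation gives \<open>\<parallel>P\<^sub>A x\<parallel> \<le> \<Sum> \<alpha>\<^sub>j \<Delta>D(j)\<close>, while testing \<open>x\<close> against signed sums of the
  \<open>e\<^sub>n\<^sup>*\<close> gives \<open>\<alpha>\<^sub>1 + \<dots> + \<alpha>\<^sub>j \<le> D\<^sup>*(j) \<parallel>x\<parallel>\<close>.  As \<open>D(j)/j\<close> and \<open>D\<^sup>*(j)/j\<close> decrease, further Abel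
  summations bound \<open>\<Sum> \<alpha>\<^sub>j \<Delta>D(j)\<close> by either \<open>T\<close> times \<open>\<parallel>x\<parallel>\<close>, and by \<open>S\<close> times \<open>\<parallel>x\<parallel>\<close> if \<open>D\<close> is
  concave.  The argument is symmetric in the two systems, so no duality theorem is needed.
  For \<open>y = x - \<Sum>\<^bsub>n\<in>B\<^esub> c\<^sub>n e\<^sub>n\<close> and a greedy set \<open>A\<close>,
  \<open>x - P\<^sub>A x = y - P\<^sub>B y - P\<^bsub>A-B\<^esub> y + P\<^bsub>B-A\<^esub> x\<close>, and the last term is controlled by \<open>y\<close> because
  the coefficients of \<open>x\<close> on \<open>B - A\<close> are dominated by those of \<open>y\<close> on \<open>A - B\<close>.

  Equality holds for the summing basis of \<open>c\<close>, where \<open>D(N) = N\<close> and \<open>D\<^sup>*(N) = 2N\<close>: the extremal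
  vectors perturb the sequence \<open>1, -1, 1, -1, \<dots>\<close>, whose coefficients after the first are \<open>\<plusminus>2\<close>, and
  in the dual they perturb the evaluation at one coordinate, whose coefficients are \<open>1, \<dots>, 1, 0, \<dots>\<close>.
\<close>

section \<open>Abel summation and quasi-concave sequences\<close>

text \<open>Summation by parts, arranged so that for decreasing nonnegative \<open>\<alpha>\<close>
  every partial sum on the right carries a nonnegative weight.\<close>

lemma abel_summation:
  fixes v :: "nat \<Rightarrow> 'b::real_vector"
  assumes "1 \<le> M"
  shows "(\<Sum>j=1..M. \<alpha> j *\<^sub>R v j)
    = \<alpha> M *\<^sub>R (\<Sum>i=1..M. v i) + (\<Sum>j=1..<M. (\<alpha> j - \<alpha> (Suc j)) *\<^sub>R (\<Sum>i=1..j. v i))"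
  using assms
proof (induction M rule: dec_induct)
  case base
  then show ?case by simp
next
  case (step M)
  then show ?case
    by (simp add: algebra_simps)
qed

text \<open>Since the weights in \<open>abel_summation\<close> are nonnegative, the triangle
  inequality can be applied to whole partial sums; the same identity read backwards for
  \<open>w\<close> restores the weighted sum.\<close>

lemma abel_norm_le:
  fixes v :: "nat \<Rightarrow> 'b::real_normed_vector"
  assumes decr: "\<And>i j. 1 \<le> i \<Longrightarrow> i \<le> j \<Longrightarrow> j \<le> M \<Longrightarrow> \<alpha> j \<le> \<alpha> i"
    and nonneg: "\<And>j. 1 \<le> j \<Longrightarrow> j \<le> M \<Longrightarrow> 0 \<le> \<alpha> j"
    and partial: "\<And>j. 1 \<le> j \<Longrightarrow> j \<le> M \<Longrightarrow> norm (\<Sum>i=1..j. v i) \<le> (\<Sum>i=1..j. w i)"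
  shows "norm (\<Sum>j=1..M. \<alpha> j *\<^sub>R v j) \<le> (\<Sum>j=1..M. \<alpha> j * w j)"
proof (cases "M = 0")
  case False
  then have M: "1 \<le> M" by simp
  have "norm (\<Sum>j=1..M. \<alpha> j *\<^sub>R v j) \<le> norm (\<alpha> M *\<^sub>R (\<Sum>i=1..M. v i))
      + (\<Sum>j=1..<M. norm ((\<alpha> j - \<alpha> (Suc j)) *\<^sub>R (\<Sum>i=1..j. v i)))"
    unfolding abel_summation[OF M]
    by (rule order_trans[OF norm_triangle_ineq add_left_mono[OF norm_sum]])
  also have "\<dots> \<le> \<alpha> M * (\<Sum>i=1..M. w i) + (\<Sum>j=1..<M. (\<alpha> j - \<alpha> (Suc j)) * (\<Sum>i=1..j. w i))"
    unfolding norm_scaleR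
    by (intro add_mono sum_mono mult_mono partial) (use M in \<open>auto intro!: nonneg decr\<close>)
  also have "\<dots> = (\<Sum>j=1..M. \<alpha> j * w j)"
    using abel_summation[OF M, of \<alpha> w] by simp
  finally show ?thesis .
qed simp

text \<open>Real counterpart of \<open>abel_norm_le\<close> without absolute values: a sequence may
  be replaced under decreasing weights by one with larger partial sums. All comparisons between the
  sums \<open>S\<close> and \<open>T\<close> are of this kind.\<close>

lemma abel_le:
  fixes u v :: "nat \<Rightarrow> real"
  assumes decr: "\<And>i j. 1 \<le> i \<Longrightarrow> i \<le> j \<Longrightarrow> j \<le> M \<Longrightarrow> \<alpha> j \<le> \<alpha> i"
    and nonneg: "\<And>j. 1 \<le> j \<Longrightarrow> j \<le> M \<Longrightarrow> 0 \<le> \<alpha> j"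
    and partial: "\<And>j. 1 \<le> j \<Longrightarrow> j \<le> M \<Longrightarrow> (\<Sum>i=1..j. u i) \<le> (\<Sum>i=1..j. v i)"
  shows "(\<Sum>j=1..M. \<alpha> j * u j) \<le> (\<Sum>j=1..M. \<alpha> j * v j)"
proof (cases "M = 0")
  case False
  then have M: "1 \<le> M" by simp
  have "\<alpha> M * (\<Sum>i=1..M. u i) + (\<Sum>j=1..<M. (\<alpha> j - \<alpha> (Suc j)) * (\<Sum>i=1..j. u i))
      \<le> \<alpha> M * (\<Sum>i=1..M. v i) + (\<Sum>j=1..<M. (\<alpha> j - \<alpha> (Suc j)) * (\<Sum>i=1..j. v i))"
    by (intro add_mono sum_mono mult_left_mono partial) (use M in \<open>auto intro!: nonneg decr\<close>)
  then show ?thesis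
    using abel_summation[OF M, of \<alpha> u] abel_summation[OF M, of \<alpha> v] by simp
qed simp

text \<open>The last clause is the division-free form of the monotonicity of
  \<open>\<eta> n / n\<close>. The value \<open>\<eta> 0 = 0\<close> agrees with the convention
  built into \<open>Delta\<close>, so that increments telescope.\<close>

definition quasi_concave :: "(nat \<Rightarrow> real) \<Rightarrow> bool" where
  "quasi_concave \<eta> \<longleftrightarrow> \<eta> 0 = 0 \<and> mono \<eta> \<and> (\<forall>n. real n * \<eta> (Suc n) \<le> real (Suc n) * \<eta> n)"

lemma quasi_concave_nonneg: "quasi_concave \<eta> \<Longrightarrow> 0 \<le> \<eta> n"
  unfolding quasi_concave_def by (metis le0 monoD)

lemma Delta_nonneg: "quasi_concave \<eta> \<Longrightarrow> 0 \<le> Delta \<eta> j"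
  using quasi_concave_nonneg[of \<eta> j] by (auto simp: Delta_def quasi_concave_def monoD)

lemma sum_Delta: "\<eta> 0 = 0 \<Longrightarrow> (\<Sum>i=1..j. Delta \<eta> i) = \<eta> j"
  by (induction j) (auto simp: Delta_def)

lemma quasi_concave_ratio_decr:
  assumes "quasi_concave \<eta>" "1 \<le> i" "i \<le> j"
  shows "\<eta> j / real j \<le> \<eta> i / real i"
  using assms(3,2)
proof (induction j rule: dec_induct)
  case (step n)
  have "real n * \<eta> (Suc n) \<le> real (Suc n) * \<eta> n"
    using assms(1) by (simp add: quasi_concave_def)
  with step have "\<eta> (Suc n) / real (Suc n) \<le> \<eta> n / real n"
    by (simp add: field_simps)
  with step show ?case by simp
qed simp

text \<open>Each of the \<open>j\<close> ratios is at least the last one,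
  \<open>\<eta> j / j\<close>. Thus the partial sums of \<open>\<eta> i / i\<close> dominate those
  of \<open>Delta \<eta>\<close>.\<close>

lemma quasi_concave_le_ratio_sum:
  assumes "quasi_concave \<eta>"
  shows "\<eta> j \<le> (\<Sum>i=1..j. \<eta> i / real i)"
proof (cases "j = 0")
  case False
  have "\<eta> j = (\<Sum>i=1..j. \<eta> j / real j)"
    using False by simp
  also have "\<dots> \<le> (\<Sum>i=1..j. \<eta> i / real i)"
    by (rule sum_mono) (simp add: quasi_concave_ratio_decr assms)
  finally show ?thesis .
qed (use assms in \<open>simp add: quasi_concave_def\<close>)

lemma concave_seq_Delta_decr:
  assumes "concave_seq \<eta>" "1 \<le> i" "i \<le> j"
  shows "Delta \<eta> j \<le> Delta \<eta> i"
  using assms(3,2)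
proof (induction j rule: dec_induct)
  case (step n)
  have "Delta \<eta> (Suc n) \<le> Delta \<eta> (Suc n - 1)"
    using step assms(1) unfolding concave_seq_def by (metis Suc_1 Suc_le_mono One_nat_def le_trans)
  with step show ?case by simp
qed simp

text \<open>The last increment is the smallest of the first \<open>j\<close>, hence at most their
  mean.\<close>

lemma concave_seq_Delta_le_ratio:
  assumes "concave_seq \<eta>" "\<eta> 0 = 0" "1 \<le> j"
  shows "Delta \<eta> j \<le> \<eta> j / real j"
proof -
  have "real j * Delta \<eta> j = (\<Sum>i=1..j. Delta \<eta> j)"
    by simp
  also have "\<dots> \<le> (\<Sum>i=1..j. Delta \<eta> i)"
    by (rule sum_mono) (simp add: concave_seq_Delta_decr assms)
  finally show ?thesis
    using assms(3) sum_Delta[of \<eta> j, OF assms(2)] by (simp add: field_simps)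
qed

lemma S_sum_commute: "S_sum \<eta> \<theta> N = S_sum \<theta> \<eta> N"
  by (simp add: S_sum_def mult.commute)

lemma T_bar_commute: "T_bar \<eta> \<theta> N = T_bar \<theta> \<eta> N"
  by (simp add: T_bar_def min.commute)

text \<open>Against \<open>T_sum \<eta> \<theta>\<close> the comparison is termwise. Against
  \<open>T_sum \<theta> \<eta>\<close> it uses \<open>Delta \<eta>\<close> as decreasing weights,
  under which \<open>Delta \<theta>\<close> is replaced by \<open>\<theta> j / j\<close>.\<close>

lemma S_sum_le_T_bar:
  assumes \<eta>: "quasi_concave \<eta>" and \<theta>: "quasi_concave \<theta>" and conc: "concave_seq \<eta>"
  shows "S_sum \<eta> \<theta> N \<le> T_bar \<eta> \<theta> N"
proof -
  have "S_sum \<eta> \<theta> N \<le> T_sum \<eta> \<theta> N"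
    unfolding S_sum_def T_sum_def
    using \<eta> by (intro sum_mono mult_right_mono concave_seq_Delta_le_ratio Delta_nonneg \<theta> conc)
      (auto simp: quasi_concave_def)
  moreover have "S_sum \<eta> \<theta> N \<le> T_sum \<theta> \<eta> N"
  proof -
    have "(\<Sum>j=1..N. Delta \<eta> j * Delta \<theta> j) \<le> (\<Sum>j=1..N. Delta \<eta> j * (\<theta> j / real j))"
      using quasi_concave_le_ratio_sum[OF \<theta>] sum_Delta[of \<theta>] \<theta>
      by (intro abel_le concave_seq_Delta_decr conc Delta_nonneg \<eta>) (auto simp: quasi_concave_def)
    then show ?thesis
      by (simp add: S_sum_def T_sum_def mult.commute)
  qed
  ultimately show ?thesis
    by (simp add: T_bar_def)
qed

text \<open>
  The only property of the constants \<open>T\<close> and \<open>S\<close> that the estimates use: here \<open>\<alpha>\<close> stands for the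
  decreasing rearrangement of coefficients, whose partial sums \<open>\<eta>\<^sub>2\<close> controls.
\<close>

definition rearrangement_bound :: "(nat \<Rightarrow> real) \<Rightarrow> (nat \<Rightarrow> real) \<Rightarrow> nat \<Rightarrow> real \<Rightarrow> bool" where
  "rearrangement_bound \<eta>1 \<eta>2 N C \<longleftrightarrow>
     (\<forall>M\<le>N. \<forall>\<alpha> t. 0 \<le> t \<longrightarrow>
        (\<forall>i j. 1 \<le> i \<and> i \<le> j \<and> j \<le> M \<longrightarrow> \<alpha> j \<le> \<alpha> i) \<longrightarrow>
        (\<forall>j. 1 \<le> j \<and> j \<le> M \<longrightarrow> 0 \<le> \<alpha> j \<and> (\<Sum>i=1..j. \<alpha> i) \<le> \<eta>2 j * t) \<longrightarrow>
        (\<Sum>j=1..M. \<alpha> j * Delta \<eta>1 j) \<le> C * t)"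

lemma rearrangement_bound_min:
  "rearrangement_bound \<eta>1 \<eta>2 N C \<Longrightarrow> rearrangement_bound \<eta>1 \<eta>2 N C' \<Longrightarrow>
    rearrangement_bound \<eta>1 \<eta>2 N (min C C')"
  by (simp add: min_def)

text \<open>A decreasing \<open>\<alpha> j\<close> is at most the mean of \<open>\<alpha> 1\<close>,
  ..., \<open>\<alpha> j\<close>, hence at most \<open>\<theta> j / j\<close> times
  \<open>t\<close>; this is inserted termwise.\<close>

lemma rearrangement_bound_T_sum_left:
  assumes \<eta>: "quasi_concave \<eta>" and \<theta>: "quasi_concave \<theta>"
  shows "rearrangement_bound \<eta> \<theta> N (T_sum \<theta> \<eta> N)"
  unfolding rearrangement_bound_def
proof (intro allI impI)
  fix M \<alpha> t
  assume M: "M \<le> N" and t: "(0::real) \<le> t"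
    and decr: "\<forall>i j. 1 \<le> i \<and> i \<le> j \<and> j \<le> M \<longrightarrow> \<alpha> j \<le> \<alpha> i"
    and part: "\<forall>j. 1 \<le> j \<and> j \<le> M \<longrightarrow> 0 \<le> \<alpha> j \<and> (\<Sum>i=1..j. \<alpha> i) \<le> \<theta> j * t"
  have le: "\<alpha> j \<le> \<theta> j / real j * t" if "j \<in> {1..M}" for j
  proof -
    have "real j * \<alpha> j = (\<Sum>i=1..j. \<alpha> j)" by simp
    also have "\<dots> \<le> (\<Sum>i=1..j. \<alpha> i)"
      using that decr by (intro sum_mono) auto
    also have "\<dots> \<le> \<theta> j * t" using part that by auto
    finally show ?thesis using that by (simp add: field_simps)
  qed
  have "(\<Sum>j=1..M. \<alpha> j * Delta \<eta> j) \<le> (\<Sum>j=1..M. \<theta> j / real j * t * Delta \<eta> j)"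
    by (intro sum_mono mult_right_mono le Delta_nonneg \<eta>)
  also have "\<dots> = T_sum \<theta> \<eta> M * t"
    by (simp add: T_sum_def sum_distrib_left sum_distrib_right mult_ac)
  also have "\<dots> \<le> T_sum \<theta> \<eta> N * t"
    unfolding T_sum_def using M
    by (intro mult_right_mono t sum_mono2)
      (auto intro!: mult_nonneg_nonneg divide_nonneg_nonneg quasi_concave_nonneg[OF \<theta>] Delta_nonneg[OF \<eta>])
  finally show "(\<Sum>j=1..M. \<alpha> j * Delta \<eta> j) \<le> T_sum \<theta> \<eta> N * t" .
qed

text \<open>Two Abel comparisons: with weights \<open>\<alpha>\<close>, \<open>Delta \<eta>\<close>
  is replaced by \<open>\<eta> j / j\<close>; then these ratios, decreasing by quasi-concavity,
  become the weights under which \<open>\<alpha>\<close> is replaced by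
  \<open>Delta \<theta>\<close> times \<open>t\<close>.\<close>

lemma rearrangement_bound_T_sum_right:
  assumes \<eta>: "quasi_concave \<eta>" and \<theta>: "quasi_concave \<theta>"
  shows "rearrangement_bound \<eta> \<theta> N (T_sum \<eta> \<theta> N)"
  unfolding rearrangement_bound_def
proof (intro allI impI)
  fix M \<alpha> t
  assume M: "M \<le> N" and t: "(0::real) \<le> t"
    and decr: "\<forall>i j. 1 \<le> i \<and> i \<le> j \<and> j \<le> M \<longrightarrow> \<alpha> j \<le> \<alpha> i"
    and part: "\<forall>j. 1 \<le> j \<and> j \<le> M \<longrightarrow> 0 \<le> \<alpha> j \<and> (\<Sum>i=1..j. \<alpha> i) \<le> \<theta> j * t"
  have \<eta>0: "\<eta> 0 = 0" and \<theta>0: "\<theta> 0 = 0"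
    using \<eta> \<theta> by (auto simp: quasi_concave_def)
  have "(\<Sum>j=1..M. \<alpha> j * Delta \<eta> j) \<le> (\<Sum>j=1..M. \<alpha> j * (\<eta> j / real j))"
    by (intro abel_le) (use decr part quasi_concave_le_ratio_sum[OF \<eta>] sum_Delta[of \<eta>, OF \<eta>0] in auto)
  also have "\<dots> = (\<Sum>j=1..M. \<eta> j / real j * \<alpha> j)"
    by (simp add: mult.commute)
  also have "\<dots> \<le> (\<Sum>j=1..M. \<eta> j / real j * (Delta \<theta> j * t))"
  proof (rule abel_le)
    fix j assume "1 \<le> j" "j \<le> M"
    then show "(\<Sum>i=1..j. \<alpha> i) \<le> (\<Sum>i=1..j. Delta \<theta> i * t)"
      using part sum_Delta[of \<theta> j, OF \<theta>0] by (simp flip: sum_distrib_right)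
  qed (use quasi_concave_nonneg[OF \<eta>] in \<open>auto intro: quasi_concave_ratio_decr \<eta>\<close>)
  also have "\<dots> = T_sum \<eta> \<theta> M * t"
    by (simp add: T_sum_def sum_distrib_left sum_distrib_right mult_ac)
  also have "\<dots> \<le> T_sum \<eta> \<theta> N * t"
    unfolding T_sum_def using M
    by (intro mult_right_mono t sum_mono2)
      (auto intro!: mult_nonneg_nonneg divide_nonneg_nonneg quasi_concave_nonneg[OF \<eta>] Delta_nonneg[OF \<theta>])
  finally show "(\<Sum>j=1..M. \<alpha> j * Delta \<eta> j) \<le> T_sum \<eta> \<theta> N * t" .
qed

lemma rearrangement_bound_T_bar:
  assumes "quasi_concave \<eta>" "quasi_concave \<theta>"
  shows "rearrangement_bound \<eta> \<theta> N (T_bar \<eta> \<theta> N)"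
  unfolding T_bar_def
  by (intro rearrangement_bound_min rearrangement_bound_T_sum_left rearrangement_bound_T_sum_right assms)

text \<open>Concavity lets \<open>Delta \<eta>\<close> itself serve as the decreasing weights, so a
  single Abel comparison replaces \<open>\<alpha>\<close> by \<open>Delta \<theta>\<close> times
  \<open>t\<close>.\<close>

lemma rearrangement_bound_S_sum:
  assumes \<eta>: "quasi_concave \<eta>" and \<theta>: "quasi_concave \<theta>" and conc: "concave_seq \<eta>"
  shows "rearrangement_bound \<eta> \<theta> N (S_sum \<eta> \<theta> N)"
  unfolding rearrangement_bound_def
proof (intro allI impI)
  fix M \<alpha> t
  assume M: "M \<le> N" and t: "(0::real) \<le> t"
    and part: "\<forall>j. 1 \<le> j \<and> j \<le> M \<longrightarrow> 0 \<le> \<alpha> j \<and> (\<Sum>i=1..j. \<alpha> i) \<le> \<theta> j * t"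
  have \<theta>0: "\<theta> 0 = 0"
    using \<theta> by (simp add: quasi_concave_def)
  have "(\<Sum>j=1..M. Delta \<eta> j * \<alpha> j) \<le> (\<Sum>j=1..M. Delta \<eta> j * (Delta \<theta> j * t))"
  proof (rule abel_le)
    fix j assume "1 \<le> j" "j \<le> M"
    then show "(\<Sum>i=1..j. \<alpha> i) \<le> (\<Sum>i=1..j. Delta \<theta> i * t)"
      using part sum_Delta[of \<theta> j, OF \<theta>0] by (simp flip: sum_distrib_right)
  qed (auto intro: concave_seq_Delta_decr conc Delta_nonneg \<eta>)
  also have "\<dots> = S_sum \<eta> \<theta> M * t"
    by (simp add: S_sum_def sum_distrib_left sum_distrib_right mult_ac)
  also have "\<dots> \<le> S_sum \<eta> \<theta> N * t"
    unfolding S_sum_def using M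
    by (intro mult_right_mono t sum_mono2) (auto intro!: mult_nonneg_nonneg Delta_nonneg \<eta> \<theta>)
  finally show "(\<Sum>j=1..M. \<alpha> j * Delta \<eta> j) \<le> S_sum \<eta> \<theta> N * t"
    by (simp add: mult.commute)
qed

section \<open>Greedy approximation in a system with coefficient functionals\<close>

text \<open>Induction on the cardinality: a minimizer of \<open>h\<close> is put in the last
  position.\<close>

lemma decreasing_enumeration:
  fixes h :: "'i \<Rightarrow> real"
  assumes "finite A"
  shows "\<exists>b. bij_betw b {1..card A} A \<and> (\<forall>i j. 1 \<le> i \<and> i \<le> j \<and> j \<le> card A \<longrightarrow> h (b j) \<le> h (b i))"
  using assms
proof (induction "card A" arbitrary: A)
  case 0
  then show ?case by (auto simp: bij_betw_def)
next
  case (Suc n)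
  then obtain k where k: "k \<in> A" "\<And>n. n \<in> A \<Longrightarrow> h k \<le> h n"
    using arg_min_if_finite[of A h] by (metis card.empty linorder_not_less nat.distinct(1))
  then have n: "n = card (A - {k})"
    using Suc by simp
  with Suc obtain b where b: "bij_betw b {1..n} (A - {k})"
    "\<forall>i j. 1 \<le> i \<and> i \<le> j \<and> j \<le> n \<longrightarrow> h (b j) \<le> h (b i)"
    by (metis finite_Diff)
  let ?b = "b(Suc n := k)"
  have "bij_betw ?b {1..n} (A - {k})"
    using b(1) by (rule bij_betw_cong[THEN iffD1, rotated]) simp
  then have "bij_betw ?b (insert (Suc n) {1..n}) (insert k (A - {k}))"
    using notIn_Un_bij_betw[of "Suc n" "{1..n}" ?b "A - {k}"] by simp
  then have "bij_betw ?b {1..Suc n} A"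
    using k(1) by (simp add: atLeastAtMostSuc_conv insert_absorb)
  moreover have "h (?b j) \<le> h (?b i)" if ij: "1 \<le> i" "i \<le> j" "j \<le> Suc n" for i j
  proof (cases "i \<le> n")
    case True
    then have "b i \<in> A"
      using ij bij_betwE[OF b(1)] by auto
    then show ?thesis
      using True ij b(2) k(2) by (cases "j = Suc n") auto
  qed (use ij in auto)
  ultimately show ?case
    unfolding Suc(2)[symmetric] by blast
qed

text \<open>Abstracts one half of a biorthogonal system; it is instantiated both by the vectors
  \<open>e\<close> and by the functionals \<open>es\<close> under \<open>dual_scale\<close>.\<close>

locale bounded_family = vector_space smul
  for smul :: "'k::real_normed_field \<Rightarrow> 'v::real_normed_vector \<Rightarrow> 'v" +
  fixes e :: "nat \<Rightarrow> 'v"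
  assumes scale_of_real: "smul (of_real r) x = r *\<^sub>R x"
    and norm_scale: "norm (smul c x) = norm c * norm x"
    and bounded_range: "bounded (range e)"
begin

abbreviation D where "D \<equiv> super_democracy smul e"

lemma norm_signed_sum_le:
  assumes "finite A" "\<And>j. j \<in> A \<Longrightarrow> norm (\<epsilon> j) = 1"
  shows "norm (\<Sum>j\<in>A. smul (\<epsilon> j) (e j)) \<le> D (card A)"
proof -
  obtain B where B: "\<And>n. norm (e n) \<le> B"
    using bounded_range by (auto simp: bounded_iff)
  have bdd: "bdd_above {norm (\<Sum>j\<in>A'. smul (\<epsilon> j) (e j)) | A' \<epsilon>.
      finite A' \<and> card A' = card A \<and> (\<forall>j. norm (\<epsilon> j) = 1)}"
  proof (rule bdd_aboveI, clarify)
    fix A' :: "nat set" and \<epsilon> :: "nat \<Rightarrow> 'k"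
    assume *: "finite A'" "card A' = card A" "\<forall>j. norm (\<epsilon> j) = 1"
    have "norm (\<Sum>j\<in>A'. smul (\<epsilon> j) (e j)) \<le> (\<Sum>j\<in>A'. B)"
      using * B by (intro sum_norm_le) (simp add: norm_scale)
    then show "norm (\<Sum>j\<in>A'. smul (\<epsilon> j) (e j)) \<le> real (card A) * B"
      using * by simp
  qed
  \<comment> \<open>The supremum defining \<open>D\<close> ranges over signs that are unimodular at
    every index, so the given ones are extended by 1 off \<open>A\<close>.\<close>
  let ?\<epsilon> = "\<lambda>j. if j \<in> A then \<epsilon> j else 1"
  have "(\<Sum>j\<in>A. smul (\<epsilon> j) (e j)) = (\<Sum>j\<in>A. smul (?\<epsilon> j) (e j))"
    by simp
  moreover have "norm (\<Sum>j\<in>A. smul (?\<epsilon> j) (e j)) \<le> D (card A)"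
    unfolding super_democracy_def
    by (rule cSup_upper[OF _ bdd], rule CollectI, rule exI[of _ A], rule exI[of _ ?\<epsilon>]) (use assms in simp)
  ultimately show ?thesis by simp
qed

lemma super_democracy_least:
  assumes "\<And>A \<epsilon>. finite A \<Longrightarrow> card A = N \<Longrightarrow> (\<And>j. norm (\<epsilon> j) = 1) \<Longrightarrow>
    norm (\<Sum>j\<in>A. smul (\<epsilon> j) (e j)) \<le> c"
  shows "D N \<le> c"
  unfolding super_democracy_def
proof (rule cSup_least)
  have "norm (\<Sum>j<N. smul 1 (e j)) \<in> {norm (\<Sum>j\<in>A. smul (\<epsilon> j) (e j)) | A \<epsilon>.
      finite A \<and> card A = N \<and> (\<forall>j. norm (\<epsilon> j) = 1)}"
    by (rule CollectI, rule exI[of _ "{..<N}"], rule exI[of _ "\<lambda>_. 1"]) simp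
  then show "{norm (\<Sum>j\<in>A. smul (\<epsilon> j) (e j)) | A \<epsilon>.
      finite A \<and> card A = N \<and> (\<forall>j. norm (\<epsilon> j) = 1)} \<noteq> {}"
    by blast
qed (use assms in auto)

text \<open>Both properties come from averaging. A signed sum over \<open>A\<close> is the mean of
  its two extensions by plus and minus a new vector, which gives monotonicity. Adding up the
  \<open>n + 1\<close> sums with one term omitted gives \<open>n\<close> times the full sum, which
  gives the decrease of \<open>D n / n\<close>.\<close>

lemma quasi_concave_super_democracy: "quasi_concave D"
  unfolding quasi_concave_def
proof (intro conjI allI)
  have "D 0 \<le> 0" by (rule super_democracy_least) simp
  moreover have "0 \<le> D 0" using norm_signed_sum_le[of "{}"] by simp
  ultimately show "D 0 = 0" by simp
  show "mono D"
    unfolding mono_iff_le_Suc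
  proof
    fix n
    show "D n \<le> D (Suc n)"
    proof (rule super_democracy_least)
      fix A :: "nat set" and \<epsilon> :: "nat \<Rightarrow> 'k"
      assume A: "finite A" "card A = n" and \<epsilon>: "\<And>j. norm (\<epsilon> j) = 1"
      obtain k where k: "k \<notin> A" using ex_new_if_finite[OF infinite_UNIV_nat] A(1) by auto
      let ?v = "\<Sum>j\<in>A. smul (\<epsilon> j) (e j)"
      have *: "norm (smul c (e k) + ?v) \<le> D (Suc n)" if c: "norm c = 1" for c
      proof -
        have "(\<Sum>j\<in>insert k A. smul ((\<epsilon>(k := c)) j) (e j)) = smul c (e k) + ?v"
          using A k by (auto intro!: sum.cong)
        then show ?thesis
          using norm_signed_sum_le[of "insert k A" "\<epsilon>(k := c)"] A k \<epsilon> c by auto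
      qed
      have "2 * norm ?v = norm ((smul 1 (e k) + ?v) + (smul (-1) (e k) + ?v))"
        by (simp flip: scaleR_2)
      also have "\<dots> \<le> D (Suc n) + D (Suc n)"
        by (rule norm_triangle_le[OF add_mono]) (rule *, simp)+
      finally show "norm ?v \<le> D (Suc n)" by simp
    qed
  qed
  fix n
  show "real n * D (Suc n) \<le> real (Suc n) * D n"
  proof (cases "n = 0")
    case True
    then show ?thesis using \<open>D 0 = 0\<close> by simp
  next
    case False
    have "D (Suc n) \<le> real (Suc n) * D n / real n"
    proof (rule super_democracy_least)
      fix A :: "nat set" and \<epsilon> :: "nat \<Rightarrow> 'k"
      assume A: "finite A" "card A = Suc n" and \<epsilon>: "\<And>j. norm (\<epsilon> j) = 1"
      let ?v = "\<Sum>j\<in>A. smul (\<epsilon> j) (e j)"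
      have "(\<Sum>k\<in>A. \<Sum>j\<in>A-{k}. smul (\<epsilon> j) (e j)) = (\<Sum>k\<in>A. ?v - smul (\<epsilon> k) (e k))"
        using A by (intro sum.cong) (auto simp: sum_diff1)
      also have "\<dots> = real n *\<^sub>R ?v"
        using A by (simp add: sum_subtractf sum_constant_scaleR algebra_simps)
      finally have "real n * norm ?v = norm (\<Sum>k\<in>A. \<Sum>j\<in>A-{k}. smul (\<epsilon> j) (e j))"
        by simp
      also have "\<dots> \<le> (\<Sum>k\<in>A. D n)"
      proof (rule sum_norm_le)
        fix k assume "k \<in> A"
        then show "norm (\<Sum>j\<in>A-{k}. smul (\<epsilon> j) (e j)) \<le> D n"
          using norm_signed_sum_le[of "A-{k}" \<epsilon>] A \<epsilon> by simp
      qed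
      finally show "norm ?v \<le> real (Suc n) * D n / real n"
        using A False by (simp add: field_simps)
    qed
    then show ?thesis using False by (simp add: field_simps)
  qed
qed

text \<open>Writing the coefficients in polar form and enumerating them by decreasing modulus leaves
  partial sums that are signed sums of \<open>j\<close> vectors, of norm at most \<open>D j\<close>.
  Abel summation then gives exactly the sum that \<open>rearrangement_bound\<close>
  controls.\<close>

lemma norm_combination_le:
  assumes C: "rearrangement_bound D E N C" and A: "finite A" "card A \<le> N" and t: "0 \<le> t"
    and a: "\<And>B. B \<subseteq> A \<Longrightarrow> (\<Sum>n\<in>B. norm (a n)) \<le> E (card B) * t"
  shows "norm (\<Sum>n\<in>A. smul (a n) (e n)) \<le> C * t"
proof -
  obtain b where b: "bij_betw b {1..card A} A"
    and decr: "\<forall>i j. 1 \<le> i \<and> i \<le> j \<and> j \<le> card A \<longrightarrow> norm (a (b j)) \<le> norm (a (b i))"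
    using decreasing_enumeration[OF A(1), of "\<lambda>n. norm (a n)"] by blast
  define \<alpha> where "\<alpha> j = norm (a (b j))" for j
  \<comment> \<open>A zero coefficient gets the sign 1, because \<open>sgn 0 = 0\<close> is not
    unimodular.\<close>
  define \<epsilon> where "\<epsilon> n = (if a n = 0 then 1 else sgn (a n))" for n
  have norm_\<epsilon>: "norm (\<epsilon> n) = 1" for n
    by (simp add: \<epsilon>_def norm_sgn)
  have polar: "smul (a n) (e n) = norm (a n) *\<^sub>R smul (\<epsilon> n) (e n)" for n
  proof -
    have "a n = of_real (norm (a n)) * \<epsilon> n"
      by (simp add: \<epsilon>_def sgn_div_norm flip: scaleR_conv_of_real)
    then have "smul (a n) (e n) = smul (of_real (norm (a n)) * \<epsilon> n) (e n)"
      by (rule arg_cong)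
    also have "\<dots> = norm (a n) *\<^sub>R smul (\<epsilon> n) (e n)"
      by (simp only: scale_of_real flip: scale_scale)
    finally show ?thesis .
  qed
  have inj: "inj_on b {1..j}" if "j \<le> card A" for j
    using bij_betw_imp_inj_on[OF b] by (rule inj_on_subset) (use that in auto)
  have sub: "b ` {1..j} \<subseteq> A" if "j \<le> card A" for j
    using bij_betw_imp_surj_on[OF b] that by force
  have "norm (\<Sum>n\<in>A. smul (a n) (e n)) = norm (\<Sum>j=1..card A. \<alpha> j *\<^sub>R smul (\<epsilon> (b j)) (e (b j)))"
    using sum.reindex_bij_betw[OF b, of "\<lambda>n. smul (a n) (e n)"] by (simp add: polar \<alpha>_def)
  also have "\<dots> \<le> (\<Sum>j=1..card A. \<alpha> j * Delta D j)"
  proof (rule abel_norm_le)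
    fix j assume j: "1 \<le> j" "j \<le> card A"
    have "norm (\<Sum>i=1..j. smul (\<epsilon> (b i)) (e (b i))) = norm (\<Sum>n\<in>b ` {1..j}. smul (\<epsilon> n) (e n))"
      using sum.reindex[OF inj[OF j(2)], of "\<lambda>n. smul (\<epsilon> n) (e n)"] by (simp add: o_def)
    also have "\<dots> \<le> D (card (b ` {1..j}))"
      by (rule norm_signed_sum_le) (simp_all add: norm_\<epsilon>)
    also have "\<dots> = (\<Sum>i=1..j. Delta D i)"
      using quasi_concave_super_democracy card_image[OF inj[OF j(2)]]
      by (subst sum_Delta) (simp_all add: quasi_concave_def)
    finally show "norm (\<Sum>i=1..j. smul (\<epsilon> (b i)) (e (b i))) \<le> (\<Sum>i=1..j. Delta D i)" .
  qed (use decr in \<open>simp_all add: \<alpha>_def\<close>)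
  also have "\<dots> \<le> C * t"
  proof -
    have "(\<Sum>i=1..j. \<alpha> i) \<le> E j * t" if "j \<le> card A" for j
      using a[OF sub[OF that]] sum.reindex[OF inj[OF that], of "\<lambda>n. norm (a n)"]
        card_image[OF inj[OF that]] by (simp add: o_def \<alpha>_def)
    then show ?thesis
      using C[unfolded rearrangement_bound_def, rule_format, of "card A" t \<alpha>] A(2) t decr
      by (simp add: \<alpha>_def)
  qed
  finally show ?thesis .
qed

end

text \<open>All that the argument retains of duality is \<open>coefficient_sum_le\<close>, in which
  \<open>E\<close> will be the democracy sequence of the opposite system.\<close>

locale coefficient_system = bounded_family smul e
  for smul :: "'k::real_normed_field \<Rightarrow> 'v::real_normed_vector \<Rightarrow> 'v" and e +
  fixes f :: "nat \<Rightarrow> 'v \<Rightarrow> 'k" and V :: "'v set" and E :: "nat \<Rightarrow> real"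
  assumes f_diff: "f n (x - y) = f n x - f n y"
    and f_scale: "f n (smul c x) = c * f n x"
    and f_e: "f n (e m) = (if n = m then 1 else 0)"
    and V_diff: "x \<in> V \<Longrightarrow> x - smul c (e n) \<in> V"
    and coefficient_sum_le: "finite A \<Longrightarrow> x \<in> V \<Longrightarrow> (\<Sum>n\<in>A. norm (f n x)) \<le> E (card A) * norm x"
begin

lemma f_combination:
  assumes "finite B"
  shows "f m (x - (\<Sum>n\<in>B. smul (c n) (e n))) = (if m \<in> B then f m x - c m else f m x)"
  using assms
proof (induction B)
  case (insert k B)
  have *: "x - (\<Sum>n\<in>insert k B. smul (c n) (e n)) = (x - (\<Sum>n\<in>B. smul (c n) (e n))) - smul (c k) (e k)"
    using insert by simp
  then show ?case
    unfolding * f_diff[of m "x - (\<Sum>n\<in>B. smul (c n) (e n))"] using insert by (auto simp: f_scale f_e)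
qed simp

lemma V_combination:
  assumes "finite B" "x \<in> V"
  shows "x - (\<Sum>n\<in>B. smul (c n) (e n)) \<in> V"
  using assms
proof (induction B)
  case (insert k B)
  have "x - (\<Sum>n\<in>insert k B. smul (c n) (e n)) = (x - (\<Sum>n\<in>B. smul (c n) (e n))) - smul (c k) (e k)"
    using insert by simp
  then show ?case
    using insert V_diff by metis
qed simp

abbreviation P where "P \<equiv> coord_proj smul e f"

lemma norm_coord_proj_le:
  assumes "rearrangement_bound D E N C" "finite A" "card A \<le> N" "x \<in> V"
  shows "norm (P A x) \<le> C * norm x"
  unfolding coord_proj_def using assms
  by (intro norm_combination_le[where E = E and N = N] coefficient_sum_le) (auto intro: finite_subset)

text \<open>A subset of \<open>B\<close> can be matched bijectively with a subset of
  \<open>A\<close> of the same size. Along this matching the coefficients of \<open>y\<close>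
  dominate those of \<open>x\<close>, so testing \<open>y\<close> bounds the coefficient sums of
  \<open>x\<close>.\<close>

lemma norm_coord_proj_le_larger_coeffs:
  assumes C: "rearrangement_bound D E N C" and B: "finite B" "card B \<le> N"
    and A: "finite A" "card B \<le> card A" and y: "y \<in> V"
    and le: "\<And>n m. n \<in> B \<Longrightarrow> m \<in> A \<Longrightarrow> norm (f n x) \<le> norm (f m y)"
  shows "norm (P B x) \<le> C * norm y"
  unfolding coord_proj_def
proof (rule norm_combination_le[OF C B])
  fix B' assume B': "B' \<subseteq> B"
  then have "card B' \<le> card A"
    using A B card_mono le_trans by blast
  then obtain A' where A': "A' \<subseteq> A" "card A' = card B'"
    using obtain_subset_with_card_n by metis
  have fin: "finite A'" "finite B'"
    using A A' B B' finite_subset by auto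
  then obtain h where h: "bij_betw h B' A'"
    using A'(2) finite_same_card_bij by metis
  have "(\<Sum>n\<in>B'. norm (f n x)) \<le> (\<Sum>n\<in>B'. norm (f (h n) y))"
    using bij_betwE[OF h] A' B' by (intro sum_mono le) auto
  also have "\<dots> = (\<Sum>n\<in>A'. norm (f n y))"
    by (rule sum.reindex_bij_betw[OF h])
  also have "\<dots> \<le> E (card B') * norm y"
    using coefficient_sum_le[OF fin(1) y] A'(2) by simp
  finally show "(\<Sum>n\<in>B'. norm (f n x)) \<le> E (card B') * norm y" .
qed simp

text \<open>Each of the three projections in the decomposition of the remainder costs
  \<open>C\<close> times the norm of \<open>y c\<close>. When \<open>c n = f n x\<close>, all
  coefficients of \<open>y c\<close> on \<open>B\<close> vanish; one projection disappears and the
  factor 3 drops to 2.\<close>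

lemma greedy_error_le:
  assumes C: "rearrangement_bound D E N C" and x: "x \<in> V" and A: "greedy_set f x N A"
    and B: "finite B" "card B \<le> N"
  defines "y \<equiv> \<lambda>c. x - (\<Sum>n\<in>B. smul (c n) (e n))"
  shows "norm (x - P A x) \<le> (1 + 3 * C) * norm (y c)"
    and "norm (x - P A x) \<le> (1 + 2 * C) * norm (x - P B x)"
proof -
  have fin: "finite A" "card A = N" and greedy: "\<And>n m. n \<in> A \<Longrightarrow> m \<notin> A \<Longrightarrow> norm (f m x) \<le> norm (f n x)"
    using A by (auto simp: greedy_set_def)
  have yV: "y c \<in> V" for c
    unfolding y_def using B(1) x by (rule V_combination)
  have fy: "f m (y c) = (if m \<in> B then f m x - c m else f m x)" for m c
    unfolding y_def using B(1) by (rule f_combination)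
  \<comment> \<open>As \<open>card B \<le> card A\<close>, removing the common part leaves
    \<open>B - A\<close> no larger than \<open>A - B\<close>.\<close>
  have AB: "card (A - B) \<le> N" "card (B - A) \<le> N" "card (B - A) \<le> card (A - B)"
    using fin B card_Diff_subset_Int[of A B] card_Diff_subset_Int[of B A]
    by (auto simp: Int_commute)
  have 1: "norm (P (A - B) (y c)) \<le> C * norm (y c)" for c
    using norm_coord_proj_le[OF C _ AB(1) yV] fin by simp
  have 2: "norm (P (B - A) x) \<le> C * norm (y c)" for c
    \<comment> \<open>On \<open>A - B\<close> the coefficients of \<open>y c\<close> are still those
      of \<open>x\<close>, so greediness of \<open>A\<close> gives the required domination.\<close>
    using AB fin B yV by (intro norm_coord_proj_le_larger_coeffs[OF C, where A = "A - B"]) (auto simp: fy greedy)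
  have P_AB: "P (A - B) (y c) = P (A - B) x" for c
    unfolding coord_proj_def by (rule sum.cong) (auto simp: fy)
  \<comment> \<open>Both sides are the projection onto the union of \<open>A\<close> and
    \<open>B\<close>.\<close>
  have split: "P A x + P (B - A) x = P B x + P (A - B) x"
    unfolding coord_proj_def using fin B
    by (metis (no_types, lifting) Un_commute sum.union_diff2 sum.union_disjoint finite_Diff Diff_disjoint Un_Diff_cancel)
  have "x - P A x = y c - P B (y c) - P (A - B) (y c) + P (B - A) x"
  proof -
    have "P B (y c) = P B x - (\<Sum>n\<in>B. smul (c n) (e n))"
      unfolding coord_proj_def by (simp add: fy scale_left_diff_distrib sum_subtractf)
    then show ?thesis
      using split P_AB[of c] by (simp add: y_def algebra_simps)
  qed
  then have "norm (x - P A x) \<le> norm (y c) + norm (P B (y c)) + norm (P (A - B) (y c)) + norm (P (B - A) x)"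
    by (smt (verit) norm_triangle_ineq norm_triangle_ineq4)
  also have "\<dots> \<le> (1 + 3 * C) * norm (y c)"
    using 1[of c] 2[of c] norm_coord_proj_le[OF C B yV[of c]] by (simp add: algebra_simps)
  finally show "norm (x - P A x) \<le> (1 + 3 * C) * norm (y c)" .
  let ?c = "\<lambda>n. f n x"
  have y: "y ?c = x - P B x"
    by (simp add: y_def coord_proj_def)
  have "x - P A x = y ?c - P (A - B) (y ?c) + P (B - A) x"
    using split P_AB[of ?c] unfolding y by (simp add: algebra_simps)
  then have "norm (x - P A x) \<le> norm (y ?c) + norm (P (A - B) (y ?c)) + norm (P (B - A) x)"
    by (smt (verit) norm_triangle_ineq norm_triangle_ineq4)
  also have "\<dots> \<le> (1 + 2 * C) * norm (y ?c)"
    using 1[of ?c] 2[of ?c] by (simp add: algebra_simps)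
  finally show "norm (x - P A x) \<le> (1 + 2 * C) * norm (x - P B x)"
    by (simp add: y)
qed

text \<open>The choice \<open>M = 0\<close>, \<open>t = 1\<close> makes the sum empty.\<close>

lemma rearrangement_bound_nonneg:
  assumes "rearrangement_bound D E N C"
  shows "0 \<le> C"
  using assms[unfolded rearrangement_bound_def, rule_format, of 0 1] by simp

text \<open>The set \<open>W\<close> is kept apart from \<open>V\<close> for the dual system: there
  \<open>V\<close> consists of all linear functionals, while the constants refer to the closed
  span.\<close>

lemma proj_const_le:
  assumes C: "rearrangement_bound D E N C" and "W \<subseteq> V"
  shows "proj_const W smul e f N \<le> ereal C"
  unfolding proj_const_def
proof (intro SUP_least, clarify)
  fix A :: "nat set" and x assume "finite A" "card A \<le> N" "x \<in> W"
  then show "ereal (norm (P A x) / norm x) \<le> ereal C"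
    using norm_coord_proj_le[OF C, of A x] rearrangement_bound_nonneg[OF C] \<open>W \<subseteq> V\<close>
    by (cases "x = 0") (auto simp: field_simps)
qed

lemma lebesgue_const_le:
  assumes C: "rearrangement_bound D E N C" and "W \<subseteq> V"
  shows "lebesgue_const W smul e f N \<le> ereal (1 + 3 * C)"
  unfolding lebesgue_const_def
proof (rule Inf_lower, clarsimp)
  fix x G assume "x \<in> W" "G \<in> greedy_operators W smul e f N"
  then obtain A where A: "greedy_set f x N A" "G x = P A x" and x: "x \<in> V"
    using \<open>W \<subseteq> V\<close> by (auto simp: greedy_operators_def)
  have pos: "0 < 1 + 3 * C"
    using rearrangement_bound_nonneg[OF C] by simp
  \<comment> \<open>Division by the positive factor turns the estimate for each approximant into a
    lower bound for the infimum.\<close>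
  have "norm (x - G x) / (1 + 3 * C) \<le> best_error smul e N x"
    unfolding best_error_def
  proof (rule cInf_greatest)
    fix r assume "r \<in> {norm (x - (\<Sum>n\<in>B. smul (c n) (e n))) | c B. finite B \<and> card B \<le> N}"
    then have "norm (x - G x) \<le> (1 + 3 * C) * r"
      using greedy_error_le(1)[OF C x A(1)] A(2) by auto
    then show "norm (x - G x) / (1 + 3 * C) \<le> r"
      using pos by (simp add: pos_divide_le_eq mult.commute)
  qed (simp, rule exI[of _ "{}"], simp)
  then show "norm (x - G x) \<le> (1 + 3 * C) * best_error smul e N x"
    using pos by (simp add: pos_divide_le_eq mult.commute)
qed

lemma proj_lebesgue_const_le:
  assumes C: "rearrangement_bound D E N C" and "W \<subseteq> V"
  shows "proj_lebesgue_const W smul e f N \<le> ereal (1 + 2 * C)"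
  unfolding proj_lebesgue_const_def
proof (rule Inf_lower, clarsimp)
  fix x G assume "x \<in> W" "G \<in> greedy_operators W smul e f N"
  then obtain A where A: "greedy_set f x N A" "G x = P A x" and x: "x \<in> V"
    using \<open>W \<subseteq> V\<close> by (auto simp: greedy_operators_def)
  have pos: "0 < 1 + 2 * C"
    using rearrangement_bound_nonneg[OF C] by simp
  have "norm (x - G x) / (1 + 2 * C) \<le> best_proj_error smul e f N x"
    unfolding best_proj_error_def
  proof (rule cInf_greatest)
    fix r assume "r \<in> {norm (x - P B x) | B. finite B \<and> card B \<le> N}"
    then have "norm (x - G x) \<le> (1 + 2 * C) * r"
      using greedy_error_le(2)[OF C x A(1)] A(2) by auto
    then show "norm (x - G x) / (1 + 2 * C) \<le> r"
      using pos by (simp add: pos_divide_le_eq mult.commute)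
  qed (simp, rule exI[of _ "{}"], simp)
  then show "norm (x - G x) \<le> (1 + 2 * C) * best_proj_error smul e f N x"
    using pos by (simp add: pos_divide_le_eq mult.commute)
qed

end

section \<open>A biorthogonal system and its dual system\<close>

lemma dual_scale_apply [simp]: "blinfun_apply (dual_scale c g) x = c * blinfun_apply g x"
  by (simp add: dual_scale_def blinfun_mult_right.rep_eq)

text \<open>The inequality from above, applied to \<open>inverse c\<close>, gives the one from
  below.\<close>

lemma norm_dual_scale:
  fixes g :: "'a::real_normed_vector \<Rightarrow>\<^sub>L 'k::real_normed_field"
  shows "norm (dual_scale c g) = norm c * norm g"
proof -
  have le: "norm (dual_scale c g) \<le> norm c * norm g" for c and g :: "'a \<Rightarrow>\<^sub>L 'k"
  proof (rule norm_blinfun_bound)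
    fix x
    show "norm (blinfun_apply (dual_scale c g) x) \<le> norm c * norm g * norm x"
      using norm_blinfun[of g x] by (simp add: norm_mult mult_left_mono mult.assoc)
  qed simp
  show ?thesis
  proof (cases "c = 0")
    case False
    have "norm c * norm g = norm c * norm (dual_scale (inverse c) (dual_scale c g))"
      using False by (intro arg_cong2[of _ _ _ _ "(*)"] refl arg_cong[of _ _ norm] blinfun_eqI) simp
    also have "\<dots> \<le> norm c * (norm (inverse c) * norm (dual_scale c g))"
      by (intro mult_left_mono le) simp
    also have "\<dots> = norm (dual_scale c g)"
      using False by (simp add: norm_inverse)
    finally show ?thesis
      using le[of c g] by simp
  qed (use le[of 0 g] in simp)
qed

lemma bounded_family_dual_scale:
  fixes es :: "nat \<Rightarrow> 'a::real_normed_vector \<Rightarrow>\<^sub>L 'k::real_normed_field"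
  assumes "bounded (range es)"
  shows "bounded_family dual_scale es"
proof (unfold_locales)
  fix a b :: 'k and f g :: "'a \<Rightarrow>\<^sub>L 'k"
  show "dual_scale a (f + g) = dual_scale a f + dual_scale a g"
    "dual_scale (a + b) f = dual_scale a f + dual_scale b f"
    "dual_scale a (dual_scale b f) = dual_scale (a * b) f"
    "dual_scale 1 f = f"
    by (auto intro!: blinfun_eqI simp: blinfun.add_left algebra_simps)
  show "dual_scale (of_real r) f = r *\<^sub>R f" for r
    by (rule blinfun_eqI) (simp add: blinfun.scaleR_left scaleR_conv_of_real)
qed (auto simp: norm_dual_scale assms)

text \<open>Multiplying each \<open>e n\<close> by the inverse sign of \<open>g (e n)\<close> aligns
  the values, so the sum of moduli is the value of \<open>g\<close> at one unimodular
  combination.\<close>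

lemma (in bounded_family) sum_norm_functional_le:
  fixes g :: "'v \<Rightarrow>\<^sub>L 'k"
  assumes g: "\<And>c x. blinfun_apply g (smul c x) = c * blinfun_apply g x" and A: "finite A"
  shows "(\<Sum>n\<in>A. norm (blinfun_apply g (e n))) \<le> D (card A) * norm g"
proof -
  define \<epsilon> where "\<epsilon> n = (if g (e n) = 0 then 1 else inverse (sgn (g (e n))))" for n
  have "of_real (norm (g (e n))) = \<epsilon> n * g (e n)" for n
    by (simp add: \<epsilon>_def sgn_div_norm scaleR_conv_of_real)
  then have "of_real (\<Sum>n\<in>A. norm (g (e n))) = g (\<Sum>n\<in>A. smul (\<epsilon> n) (e n))"
    by (simp add: blinfun.sum_right g)
  then have "\<bar>\<Sum>n\<in>A. norm (g (e n))\<bar> = norm (g (\<Sum>n\<in>A. smul (\<epsilon> n) (e n)))"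
    by (metis norm_of_real)
  also have "\<dots> \<le> norm g * norm (\<Sum>n\<in>A. smul (\<epsilon> n) (e n))"
    by (rule norm_blinfun)
  also have "\<dots> \<le> norm g * D (card A)"
    by (intro mult_left_mono norm_signed_sum_le A) (simp_all add: \<epsilon>_def norm_inverse norm_sgn)
  finally show ?thesis
    by (simp add: mult.commute)
qed

text \<open>The same alignment with the roles reversed: \<open>x\<close> is tested against one
  unimodular combination of the functionals.\<close>

lemma sum_norm_coefficients_le:
  fixes es :: "nat \<Rightarrow> 'a::real_normed_vector \<Rightarrow>\<^sub>L 'k::real_normed_field"
  assumes "bounded (range es)" and A: "finite A"
  shows "(\<Sum>n\<in>A. norm (blinfun_apply (es n) x)) \<le> D_star es (card A) * norm x"
proof -
  interpret bounded_family dual_scale es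
    by (rule bounded_family_dual_scale) fact
  define \<epsilon> where "\<epsilon> n = (if es n x = 0 then 1 else inverse (sgn (es n x)))" for n
  have "of_real (norm (es n x)) = \<epsilon> n * es n x" for n
    by (simp add: \<epsilon>_def sgn_div_norm scaleR_conv_of_real)
  then have "of_real (\<Sum>n\<in>A. norm (es n x)) = (\<Sum>n\<in>A. dual_scale (\<epsilon> n) (es n)) x"
    by (simp add: blinfun.sum_left)
  then have "\<bar>\<Sum>n\<in>A. norm (es n x)\<bar> = norm ((\<Sum>n\<in>A. dual_scale (\<epsilon> n) (es n)) x)"
    by (metis norm_of_real)
  also have "\<dots> \<le> norm (\<Sum>n\<in>A. dual_scale (\<epsilon> n) (es n)) * norm x"
    by (rule norm_blinfun)
  also have "\<dots> \<le> D_star es (card A) * norm x"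
    by (intro mult_right_mono norm_signed_sum_le A) (simp_all add: \<epsilon>_def norm_inverse norm_sgn)
  finally show ?thesis
    by simp
qed

context seminormalized_complete_biorthogonal_system
begin

lemma bounded_system: "bounded (range e)" "bounded (range es)"
  using seminormalized by (auto simp: bounded_iff)

text \<open>Here \<open>'a\<close> is the scalar field and \<open>'b\<close> the space. Bounded maps
  of this type are only real-linear, so the dual space over \<open>'a\<close> has to be singled
  out.\<close>

definition linear_functionals :: "('b \<Rightarrow>\<^sub>L 'a) set" where
  "linear_functionals = {g. \<forall>c x. blinfun_apply g (smul c x) = c * blinfun_apply g x}"

sublocale dual: bounded_family dual_scale es
  by (rule bounded_family_dual_scale) (rule bounded_system)

sublocale primal: bounded_family smul e
  by unfold_locales (simp_all add: scale_of_real norm_scale bounded_system)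

sublocale primal: coefficient_system smul e "\<lambda>n. blinfun_apply (es n)" UNIV "D_star es"
  by unfold_locales
    (simp_all add: blinfun.diff_right es_scale biorthogonal sum_norm_coefficients_le bounded_system)

text \<open>The roles are exchanged: the coordinate functionals are evaluations at the
  \<open>e n\<close>, and their sums are controlled by the democracy sequence of
  \<open>e\<close>.\<close>

sublocale dual: coefficient_system dual_scale es "\<lambda>n g. blinfun_apply g (e n)" linear_functionals
    "super_democracy smul e"
  by unfold_locales
    (simp_all add: blinfun.diff_left biorthogonal linear_functionals_def es_scale
      primal.sum_norm_functional_le right_diff_distrib mult.left_commute)

text \<open>The linear functionals form a subspace containing \<open>es\<close>, and it is closed,
  being an intersection of closed conditions.\<close>

lemma dual_closed_span_subset: "dual_closed_span es \<subseteq> linear_functionals"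
  unfolding dual_closed_span_def
proof (rule closure_minimal)
  show "module.span dual_scale (range es) \<subseteq> linear_functionals"
    by (rule dual.span_minimal)
      (auto simp: dual.subspace_def linear_functionals_def es_scale blinfun.add_left algebra_simps)
  have "linear_functionals = (\<Inter>c x. {g. blinfun_apply g (smul c x) = c * blinfun_apply g x})"
    by (auto simp: linear_functionals_def)
  moreover have "closed {g :: 'b \<Rightarrow>\<^sub>L 'a. blinfun_apply g (smul c x) = c * blinfun_apply g x}" for c x
    by (intro closed_Collect_eq continuous_intros)
  ultimately show "closed linear_functionals"
    by (simp add: closed_INT)
qed

lemma primal_estimates:
  assumes "rearrangement_bound (super_democracy smul e) (D_star es) N C"
  shows "K_const smul e es N \<le> ereal C" "L_const smul e es N \<le> ereal (1 + 3 * C)"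
    "Lt_const smul e es N \<le> ereal (1 + 2 * C)"
  using assms by (auto intro: primal.proj_const_le primal.lebesgue_const_le primal.proj_lebesgue_const_le)

lemma dual_estimates:
  assumes "rearrangement_bound (D_star es) (super_democracy smul e) N C"
  shows "K_star e es N \<le> ereal C" "L_star e es N \<le> ereal (1 + 3 * C)"
    "Lt_star e es N \<le> ereal (1 + 2 * C)"
  using assms dual_closed_span_subset
  by (auto intro: dual.proj_const_le dual.lebesgue_const_le dual.proj_lebesgue_const_le)

lemma T_bar_estimates:
  fixes N
  defines "T \<equiv> T_bar (super_democracy smul e) (D_star es) N"
  shows "K_const smul e es N \<le> ereal T" "L_const smul e es N \<le> ereal (1 + 3 * T)"
    "L_star e es N \<le> ereal (1 + 3 * T)" "Lt_const smul e es N \<le> ereal (1 + 2 * T)"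
    "Lt_star e es N \<le> ereal (1 + 2 * T)"
  using primal_estimates[OF rearrangement_bound_T_bar] dual_estimates[OF rearrangement_bound_T_bar]
    primal.quasi_concave_super_democracy dual.quasi_concave_super_democracy
  by (simp_all add: T_def T_bar_commute[of "D_star es"])

lemma S_sum_estimates:
  fixes N
  defines "D \<equiv> super_democracy smul e" and "Ds \<equiv> D_star es"
  defines "S \<equiv> S_sum D Ds N"
  shows "concave_seq D \<Longrightarrow> S \<le> T_bar D Ds N \<and> K_const smul e es N \<le> ereal S \<and>
      L_const smul e es N \<le> ereal (1 + 3 * S) \<and> Lt_const smul e es N \<le> ereal (1 + 2 * S)"
    and "concave_seq Ds \<Longrightarrow> S \<le> T_bar D Ds N \<and> K_star e es N \<le> ereal S \<and>
      L_star e es N \<le> ereal (1 + 3 * S) \<and> Lt_star e es N \<le> ereal (1 + 2 * S)"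
  using primal_estimates[OF rearrangement_bound_S_sum] dual_estimates[OF rearrangement_bound_S_sum]
    primal.quasi_concave_super_democracy dual.quasi_concave_super_democracy
    S_sum_le_T_bar[of D Ds] S_sum_le_T_bar[of Ds D]
  by (simp_all add: D_def Ds_def S_def S_sum_commute[of "D_star es"] T_bar_commute[of "D_star es"])

end

section \<open>Lower bounds for the constants\<close>

text \<open>A greedy set is enlarged by an index of maximal coefficient outside it. The maximum is
  attained because only finitely many null coefficients reach the modulus of a given nonzero one; if
  all of them vanish, any outside index works.\<close>

lemma greedy_set_exists:
  fixes f :: "nat \<Rightarrow> 'v \<Rightarrow> 'k::real_normed_field"
  assumes null: "(\<lambda>n. f n x) \<longlonglongrightarrow> 0"
  shows "\<exists>A. greedy_set f x N A"
proof (induction N)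
  case 0
  then show ?case
    by (intro exI[of _ "{}"]) (simp add: greedy_set_def)
next
  case (Suc N)
  then obtain A where A: "finite A" "card A = N" "\<And>n m. n \<in> A \<Longrightarrow> m \<notin> A \<Longrightarrow> norm (f m x) \<le> norm (f n x)"
    by (auto simp: greedy_set_def)
  obtain k where k: "k \<notin> A" "\<And>m. m \<notin> A \<Longrightarrow> norm (f m x) \<le> norm (f k x)"
  proof (cases "\<forall>m. m \<notin> A \<longrightarrow> f m x = 0")
    case True
    then show ?thesis
      using that ex_new_if_finite[OF infinite_UNIV_nat A(1)] by fastforce
  next
    case False
    then obtain l where l: "l \<notin> A" "f l x \<noteq> 0" by blast
    obtain n0 where n0: "\<And>n. n \<ge> n0 \<Longrightarrow> norm (f n x) < norm (f l x)"
      using LIMSEQ_D[OF null, of "norm (f l x)"] l(2) by auto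
    let ?S = "{m. m \<notin> A \<and> norm (f l x) \<le> norm (f m x)}"
    have "?S \<subseteq> {..<n0}"
      using n0 by (force simp: not_le[symmetric])
    then have fin: "finite ?S"
      using finite_subset by blast
    let ?h = "\<lambda>m. norm (f m x)"
    have "Max (?h ` ?S) \<in> ?h ` ?S"
      using fin l(1) by (intro Max_in) auto
    then obtain k where k: "k \<in> ?S" "?h k = Max (?h ` ?S)"
      by force
    have max: "?h m \<le> ?h k" if "m \<in> ?S" for m
      unfolding k(2) using fin that by (intro Max_ge) auto
    show ?thesis
    proof (rule that)
      show "k \<notin> A" using k(1) by simp
      show "norm (f m x) \<le> norm (f k x)" if "m \<notin> A" for m
        using k(1) max[of m] that by (cases "norm (f l x) \<le> norm (f m x)") auto
    qed
  qed
  have "greedy_set f x (Suc N) (insert k A)"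
    using A k by (auto simp: greedy_set_def)
  then show ?case ..
qed

text \<open>A greedy operator selects a greedy set at every point of \<open>V\<close>. The
  prescribed set is used at \<open>x\<close>, and existence elsewhere follows from the decay of the
  coefficients.\<close>

lemma greedy_operator_exists:
  fixes f :: "nat \<Rightarrow> 'v::real_normed_vector \<Rightarrow> 'k::real_normed_field"
  assumes null: "\<And>x. x \<in> V \<Longrightarrow> (\<lambda>n. f n x) \<longlonglongrightarrow> 0" and A: "greedy_set f x N A"
  shows "\<exists>G\<in>greedy_operators V smul e f N. G x = coord_proj smul e f A x"
proof -
  define S where "S z = (if z = x then A else SOME A. greedy_set f z N A)" for z
  have "greedy_set f z N (S z)" if "z \<in> V" for z
    using someI_ex[OF greedy_set_exists[of f z N, OF null[OF that]]] A by (simp add: S_def)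
  then have "(\<lambda>z. coord_proj smul e f (S z) z) \<in> greedy_operators V smul e f N"
    by (auto simp: greedy_operators_def)
  then show ?thesis
    by (rule bexI[rotated]) (simp add: S_def)
qed

text \<open>An admissible constant is not known in advance to be nonnegative; the positivity of
  \<open>r\<close> excludes \<open>C \<le> 0\<close>.\<close>

lemma constant_ge:
  fixes r C \<sigma> :: real
  assumes "r \<le> C * \<sigma>" "0 \<le> \<sigma>" "\<sigma> \<le> 1" "0 < r"
  shows "r \<le> C"
proof (cases "C \<le> 0")
  case True
  then have "C * \<sigma> \<le> 0"
    using assms(2) by (simp add: mult_nonpos_nonneg)
  with assms show ?thesis by linarith
next
  case False
  then have "C * \<sigma> \<le> C"
    using assms(3) by (simp add: mult_left_le)
  with assms show ?thesis by linarith
qed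

text \<open>A single vector suffices: it must have an approximant with at most \<open>N\<close>
  terms and error at most 1, but a greedy remainder of norm at least \<open>r\<close>.\<close>

lemma lebesgue_const_ge:
  fixes f :: "nat \<Rightarrow> 'v::real_normed_vector \<Rightarrow> 'k::real_normed_field"
  assumes null: "\<And>x. x \<in> V \<Longrightarrow> (\<lambda>n. f n x) \<longlonglongrightarrow> 0" and x: "x \<in> V" and A: "greedy_set f x N A"
    and B: "finite B" "card B \<le> N" "norm (x - (\<Sum>n\<in>B. smul (c n) (e n))) \<le> 1"
    and r: "r \<le> norm (x - coord_proj smul e f A x)" "0 < r"
  shows "ereal r \<le> lebesgue_const V smul e f N"
  unfolding lebesgue_const_def
proof (rule Inf_greatest, clarsimp)
  fix C
  assume C: "\<forall>x\<in>V. \<forall>G\<in>greedy_operators V smul e f N. norm (x - G x) \<le> C * best_error smul e N x"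
  obtain G where G: "G \<in> greedy_operators V smul e f N" "G x = coord_proj smul e f A x"
    using greedy_operator_exists[where f = f and V = V and N = N, OF null A] by blast
  have "r \<le> C * best_error smul e N x"
    using C x G r(1) by fastforce
  moreover have "0 \<le> best_error smul e N x"
    unfolding best_error_def by (rule cInf_greatest) (use B in auto)
  moreover have "best_error smul e N x \<le> norm (x - (\<Sum>n\<in>B. smul (c n) (e n)))"
    unfolding best_error_def by (rule cInf_lower) (use B in \<open>auto intro: bdd_belowI[of _ 0]\<close>)
  ultimately show "r \<le> C"
    using B(3) r(2) by (intro constant_ge[of r C "best_error smul e N x"]) linarith+
qed

lemma proj_lebesgue_const_ge:
  fixes f :: "nat \<Rightarrow> 'v::real_normed_vector \<Rightarrow> 'k::real_normed_field"
  assumes null: "\<And>x. x \<in> V \<Longrightarrow> (\<lambda>n. f n x) \<longlonglongrightarrow> 0" and x: "x \<in> V" and A: "greedy_set f x N A"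
    and B: "finite B" "card B \<le> N" "norm (x - coord_proj smul e f B x) \<le> 1"
    and r: "r \<le> norm (x - coord_proj smul e f A x)" "0 < r"
  shows "ereal r \<le> proj_lebesgue_const V smul e f N"
  unfolding proj_lebesgue_const_def
proof (rule Inf_greatest, clarsimp)
  fix C
  assume C: "\<forall>x\<in>V. \<forall>G\<in>greedy_operators V smul e f N. norm (x - G x) \<le> C * best_proj_error smul e f N x"
  obtain G where G: "G \<in> greedy_operators V smul e f N" "G x = coord_proj smul e f A x"
    using greedy_operator_exists[where f = f and V = V and N = N, OF null A] by blast
  have "r \<le> C * best_proj_error smul e f N x"
    using C x G r(1) by fastforce
  moreover have "0 \<le> best_proj_error smul e f N x"
    unfolding best_proj_error_def by (rule cInf_greatest) (use B in auto)
  moreover have "best_proj_error smul e f N x \<le> norm (x - coord_proj smul e f B x)"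
    unfolding best_proj_error_def by (rule cInf_lower) (use B in \<open>auto intro: bdd_belowI[of _ 0]\<close>)
  ultimately show "r \<le> C"
    using B(3) r(2) by (intro constant_ge[of r C "best_proj_error smul e f N x"]) linarith+
qed

lemma proj_const_ge:
  assumes A: "finite A" "card A \<le> N" and x: "x \<in> V" "x \<noteq> 0" "norm x \<le> 1"
  shows "ereal (norm (coord_proj smul e f A x)) \<le> proj_const V smul e f N"
proof -
  have "norm (coord_proj smul e f A x) * norm x \<le> norm (coord_proj smul e f A x)"
    using x by (simp add: mult_left_le)
  then have "ereal (norm (coord_proj smul e f A x)) \<le> ereal (norm (coord_proj smul e f A x) / norm x)"
    using x by (simp add: pos_le_divide_eq)
  also have "\<dots> \<le> proj_const V smul e f N"
    unfolding proj_const_def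
    by (rule SUP_upper2[of A], use A in simp, rule SUP_upper[OF x(1)])
  finally show ?thesis .
qed

section \<open>The summing basis\<close>

text \<open>Meaningful for convergent \<open>s\<close>, which is bounded and, \<open>nat\<close>
  being discrete, continuous.\<close>

definition conv_of :: "(nat \<Rightarrow> 'k) \<Rightarrow> 'k::real_normed_vector conv_seq" where
  "conv_of s = Conv_seq (Bcontfun s)"

lemma seq_of_conv_of:
  assumes "convergent s"
  shows "apply_bcontfun (seq_of (conv_of s)) = s"
proof -
  have "s \<in> bcontfun"
    using assms convergent_imp_bounded by (auto simp: bcontfun_def convergent_def)
  then have "apply_bcontfun (Bcontfun s) = s"
    by (rule Bcontfun_inverse)
  then show ?thesis
    using assms by (simp add: conv_of_def Conv_seq_inverse)
qed

lemma convergent_seq_of: "convergent (apply_bcontfun (seq_of x))"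
  using seq_of[of x] by simp

lemma convergent_eventually_const: "(\<And>m. m \<ge> M \<Longrightarrow> s m = c) \<Longrightarrow> convergent s"
  unfolding convergent_def by (intro exI[of _ c] tendsto_eventually eventually_sequentiallyI)

lemma conv_seq_eqI: "(\<And>n. apply_bcontfun (seq_of x) n = apply_bcontfun (seq_of y) n) \<Longrightarrow> x = y"
  by (metis bcontfun_eqI seq_of_inject)

lemma norm_seq_of_le: "norm (apply_bcontfun (seq_of x) n) \<le> norm x"
  by (simp add: norm_conv_seq.rep_eq norm_bounded)

lemma norm_conv_seq_le: "(\<And>n. norm (apply_bcontfun (seq_of x) n) \<le> b) \<Longrightarrow> norm x \<le> b"
  by (simp add: norm_conv_seq.rep_eq norm_bound)

lemma seq_of_simps [simp]:
  "apply_bcontfun (seq_of 0) n = 0"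
  "apply_bcontfun (seq_of (x + y)) n = apply_bcontfun (seq_of x) n + apply_bcontfun (seq_of y) n"
  "apply_bcontfun (seq_of (x - y)) n = apply_bcontfun (seq_of x) n - apply_bcontfun (seq_of y) n"
  "apply_bcontfun (seq_of (- x)) n = - apply_bcontfun (seq_of x) n"
  "apply_bcontfun (seq_of (r *\<^sub>R x)) n = r *\<^sub>R apply_bcontfun (seq_of x) n"
  by (simp_all add: zero_conv_seq.rep_eq plus_conv_seq.rep_eq minus_conv_seq.rep_eq uminus_conv_seq.rep_eq scaleR_conv_seq.rep_eq
    zero_bcontfun.rep_eq plus_bcontfun.rep_eq minus_bcontfun.rep_eq uminus_bcontfun.rep_eq scaleR_bcontfun.rep_eq)

lemma seq_of_sum [simp]:
  "apply_bcontfun (seq_of (sum g A)) n = (\<Sum>i\<in>A. apply_bcontfun (seq_of (g i)) n)"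
  by (induction A rule: infinite_finite_induct) simp_all

definition conv_scale :: "'k::real_normed_field \<Rightarrow> 'k conv_seq \<Rightarrow> 'k conv_seq" where
  "conv_scale c x = conv_of (\<lambda>n. c * apply_bcontfun (seq_of x) n)"

lemma seq_of_conv_scale [simp]:
  "apply_bcontfun (seq_of (conv_scale c x)) n = c * apply_bcontfun (seq_of x) n"
proof -
  have "convergent (\<lambda>n. c * apply_bcontfun (seq_of x) n)"
    using convergent_seq_of[of x] by (auto simp: convergent_def intro: tendsto_mult_left)
  then show ?thesis
    by (simp add: conv_scale_def seq_of_conv_of)
qed

text \<open>The summing basis of c; \<open>step 0\<close> is the constant sequence 1.\<close>

definition step :: "nat \<Rightarrow> 'k::real_normed_field conv_seq" where
  "step n = conv_of (\<lambda>m. if n \<le> m then 1 else 0)"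

lemma seq_of_step [simp]: "apply_bcontfun (seq_of (step n)) m = (if n \<le> m then 1 else 0)"
  unfolding step_def by (subst seq_of_conv_of) (auto intro: convergent_eventually_const[of n])

definition increment :: "(nat \<Rightarrow> 'b::ab_group_add) \<Rightarrow> nat \<Rightarrow> 'b" where
  "increment v n = v n - (if n = 0 then 0 else v (n - 1))"

lemma sum_increment: "(\<Sum>n\<le>k. increment v n) = v k"
  by (induction k) (auto simp: increment_def)

text \<open>The coordinate functionals of the summing basis: by telescoping, the coordinates of a
  sequence are its increments, the first one being its initial value.\<close>

definition jump :: "nat \<Rightarrow> 'k conv_seq \<Rightarrow>\<^sub>L 'k::real_normed_field" where
  "jump n = Blinfun (\<lambda>x. increment (apply_bcontfun (seq_of x)) n)"

lemma norm_increment_le: "norm (increment (apply_bcontfun (seq_of x)) n) \<le> 2 * norm x"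
proof (cases "n = 0")
  case True
  then show ?thesis
    using norm_seq_of_le[of x 0] norm_ge_zero[of x] unfolding increment_def by (simp del: norm_ge_zero)
next
  case False
  then show ?thesis
    using norm_triangle_ineq4[of "apply_bcontfun (seq_of x) n" "apply_bcontfun (seq_of x) (n - 1)"]
      norm_seq_of_le[of x n] norm_seq_of_le[of x "n - 1"] unfolding increment_def by simp
qed

lemma jump_apply: "blinfun_apply (jump n) x = increment (apply_bcontfun (seq_of x)) n"
proof -
  have "bounded_linear (\<lambda>x :: 'a conv_seq. increment (apply_bcontfun (seq_of x)) n)"
  proof (rule bounded_linear_intro[of _ 2])
    show "norm (increment (apply_bcontfun (seq_of x)) n) \<le> norm x * 2" for x :: "'a conv_seq"
      using norm_increment_le[of x n] by simp
  qed (auto simp: increment_def algebra_simps)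
  then show ?thesis
    by (simp add: jump_def bounded_linear_Blinfun_apply)
qed

text \<open>A finite expansion in the summing basis: the sequence \<open>v\<close> frozen from index
  \<open>M\<close> on.\<close>

definition simple_seq :: "nat \<Rightarrow> (nat \<Rightarrow> 'k) \<Rightarrow> 'k::real_normed_field conv_seq" where
  "simple_seq M v = (\<Sum>n\<le>M. conv_scale (increment v n) (step n))"

lemma seq_of_simple_seq [simp]: "apply_bcontfun (seq_of (simple_seq M v)) m = v (min m M)"
proof -
  have "apply_bcontfun (seq_of (simple_seq M v)) m = (\<Sum>n\<le>M. if n \<le> m then increment v n else 0)"
    unfolding simple_seq_def seq_of_sum by (rule sum.cong) auto
  also have "\<dots> = (\<Sum>n\<in>{n \<in> {..M}. n \<le> m}. increment v n)"
    by (rule sum.inter_filter[symmetric]) simp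
  also have "{n \<in> {..M}. n \<le> m} = {..min m M}"
    by auto
  finally show ?thesis
    by (simp only: sum_increment)
qed

text \<open>Past a suitable \<open>M\<close> a convergent sequence stays close to its
  \<open>M\<close>-th term, so only finitely many values have to be approximated. A countable
  \<open>Q\<close> gives separability; \<open>Q = UNIV\<close> gives completeness of the
  system.\<close>

lemma simple_seq_dense:
  fixes x :: "'k::real_normed_field conv_seq"
  assumes Q: "closure Q = UNIV" and "0 < \<epsilon>"
  shows "\<exists>M v. (\<forall>n. v n \<in> Q) \<and> dist (simple_seq M v) x < \<epsilon>"
proof -
  have "\<exists>q\<in>Q. dist q (apply_bcontfun (seq_of x) n) < \<epsilon> / 3" for n
    using Q \<open>0 < \<epsilon>\<close> by (metis UNIV_I closure_approachable divide_pos_pos zero_less_numeral)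
  then obtain v where v: "\<And>n. v n \<in> Q" "\<And>n. dist (v n) (apply_bcontfun (seq_of x) n) < \<epsilon> / 3"
    by metis
  obtain M where M: "\<And>m. m \<ge> M \<Longrightarrow> dist (apply_bcontfun (seq_of x) M) (apply_bcontfun (seq_of x) m) < \<epsilon> / 3"
    using metric_CauchyD[OF convergent_Cauchy[OF convergent_seq_of[of x]], of "\<epsilon> / 3"] \<open>0 < \<epsilon>\<close>
    by (metis divide_pos_pos order_refl zero_less_numeral)
  have "norm (simple_seq M v - x) \<le> 2 * \<epsilon> / 3"
  proof (rule norm_conv_seq_le)
    fix m
    have "dist (v (min m M)) (apply_bcontfun (seq_of x) m) \<le> 2 * \<epsilon> / 3"
    proof (cases "m \<le> M")
      case True
      then show ?thesis using v(2)[of m] \<open>0 < \<epsilon>\<close> by simp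
    next
      case False
      then show ?thesis
        using v(2)[of M] M[of m] dist_triangle[of "v M" "apply_bcontfun (seq_of x) m" "apply_bcontfun (seq_of x) M"]
        by (simp add: min_def)
    qed
    then show "norm (apply_bcontfun (seq_of (simple_seq M v - x)) m) \<le> 2 * \<epsilon> / 3"
      by (simp add: dist_norm)
  qed
  then have "dist (simple_seq M v) x < \<epsilon>"
    using \<open>0 < \<epsilon>\<close> by (simp add: dist_norm)
  then show ?thesis
    using v(1) by blast
qed

lemma separable_conv_seq:
  "separable_space (euclidean :: 'k::{real_normed_field,euclidean_space} conv_seq topology)"
proof -
  obtain Q :: "'k set" where Q: "countable Q" "UNIV \<subseteq> closure Q"
    by (rule separable)
  then have Q_dense: "closure Q = UNIV"
    by blast
  \<comment> \<open>Only the values of \<open>v\<close> up to \<open>M\<close> matter, so lists over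
    \<open>Q\<close> suffice and keep the set countable.\<close>
  define S :: "'k conv_seq set" where "S = (\<lambda>(M, l). simple_seq M ((!) l)) ` (UNIV \<times> lists Q)"
  have "countable S"
    unfolding S_def using Q(1) by (intro countable_image countable_SIGMA countable_lists) auto
  moreover have "closure S = UNIV"
  proof (intro equalityI subsetI UNIV_I)
    fix x :: "'k conv_seq"
    show "x \<in> closure S"
      unfolding closure_approachable
    proof (intro allI impI)
      fix \<epsilon> :: real assume "0 < \<epsilon>"
      then obtain M v where v: "\<And>n. v n \<in> Q" "dist (simple_seq M v) x < \<epsilon>"
        using simple_seq_dense[OF Q_dense] by blast
      let ?l = "map v [0..<Suc M]"
      have "simple_seq M v = simple_seq M ((!) ?l)"
        by (rule conv_seq_eqI) (simp del: upt_Suc)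
      moreover have "?l \<in> lists Q"
        using v(1) by auto
      ultimately have "simple_seq M v \<in> S"
        unfolding S_def by (intro image_eqI[of _ _ "(M, ?l)"]) auto
      with v(2) show "\<exists>y\<in>S. dist y x < \<epsilon>" ..
    qed
  qed
  ultimately show ?thesis
    unfolding separable_space_def by auto
qed

lemma vector_space_conv_scale: "vector_space (conv_scale :: 'k::real_normed_field \<Rightarrow> _)"
  by unfold_locales (auto intro!: conv_seq_eqI simp: algebra_simps)

lemma norm_conv_scale: "norm (conv_scale c x) = norm c * norm x"
proof -
  have le: "norm (conv_scale c x) \<le> norm c * norm x" for c and x :: "'a conv_seq"
    by (rule norm_conv_seq_le) (simp add: norm_mult mult_left_mono norm_seq_of_le)
  show ?thesis
  proof (cases "c = 0")
    case False
    have "norm c * norm x = norm c * norm (conv_scale (inverse c) (conv_scale c x))"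
      using False by (intro arg_cong2[of _ _ _ _ "(*)"] refl arg_cong[of _ _ norm] conv_seq_eqI) simp
    also have "\<dots> \<le> norm c * (norm (inverse c) * norm (conv_scale c x))"
      by (intro mult_left_mono le) simp
    also have "\<dots> = norm (conv_scale c x)"
      using False by (simp add: norm_inverse)
    finally show ?thesis
      using le[of c x] by simp
  qed (use le[of 0 x] in simp)
qed

lemma jump_step: "blinfun_apply (jump n) (step m) = (if n = m then 1 else 0)"
  by (auto simp: jump_apply increment_def)

lemma jump_conv_scale: "blinfun_apply (jump n) (conv_scale c x) = c * blinfun_apply (jump n) x"
  by (simp add: jump_apply increment_def right_diff_distrib)

lemma norm_step: "norm (step n) = 1"
proof (rule antisym)
  show "norm (step n) \<le> 1"
    by (rule norm_conv_seq_le) simp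
  show "1 \<le> norm (step n)"
    using norm_seq_of_le[of "step n" n] by simp
qed

lemma norm_jump_le: "norm (jump n) \<le> 2"
  by (rule norm_blinfun_bound) (simp_all add: jump_apply norm_increment_le)

lemma norm_jump_ge: "1 \<le> norm (jump n)"
  using norm_blinfun[of "jump n" "step n"] by (simp add: jump_step norm_step)

interpretation conv: vector_space "conv_scale :: 'k::real_normed_field \<Rightarrow> 'k conv_seq \<Rightarrow> 'k conv_seq"
  by (rule vector_space_conv_scale)

text \<open>Each \<open>jump n\<close> vanishes on the other steps but not on \<open>step n\<close>,
  so the steps are an infinite independent set.\<close>

lemma infinite_dim_conv_seq:
  "\<nexists>B :: 'k::real_normed_field conv_seq set. finite B \<and> conv.span B = UNIV"
proof
  assume "\<exists>B :: 'k conv_seq set. finite B \<and> conv.span B = UNIV"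
  then obtain B :: "'k conv_seq set" where B: "finite B" "conv.span B = UNIV"
    by blast
  have "conv.independent (range step :: 'k conv_seq set)"
    unfolding conv.dependent_def
  proof (clarify)
    fix n
    assume n: "(step n :: 'k conv_seq) \<in> conv.span (range step - {step n})"
    have "conv.span (range step - {step n}) \<subseteq> {x :: 'k conv_seq. jump n x = 0}"
      by (rule conv.span_minimal)
        (auto simp: conv.subspace_def jump_step jump_conv_scale blinfun.add_right)
    with n show False
      by (auto simp: jump_step)
  qed
  then have "finite (range step :: 'k conv_seq set)"
    using conv.independent_span_bound[OF B(1)] B(2) by auto
  moreover have "inj (step :: nat \<Rightarrow> 'k conv_seq)"
    by (rule injI) (metis jump_step zero_neq_one)
  ultimately show False
    using finite_imageD by blast
qed

lemma summing_basis:
  "seminormalized_complete_biorthogonal_system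
    (conv_scale :: 'k::{real_normed_field,euclidean_space} \<Rightarrow> _) step jump"
proof (unfold_locales)
  show "conv_scale (of_real r) x = r *\<^sub>R x" for r and x :: "'k conv_seq"
    by (rule conv_seq_eqI) (simp add: scaleR_conv_of_real)
  show "\<exists>A B. 0 < A \<and> 0 < B \<and> (\<forall>n. A \<le> norm (step n :: 'k conv_seq) \<and> norm (step n :: 'k conv_seq) \<le> B \<and>
      A \<le> norm (jump n :: 'k conv_seq \<Rightarrow>\<^sub>L 'k) \<and> norm (jump n :: 'k conv_seq \<Rightarrow>\<^sub>L 'k) \<le> B)"
    by (intro exI[of _ 1] exI[of _ 2]) (simp add: norm_step norm_jump_le norm_jump_ge)
  show "closure (conv.span (range (step :: nat \<Rightarrow> 'k conv_seq))) = UNIV"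
  proof (intro equalityI subsetI UNIV_I)
    fix x :: "'k conv_seq"
    have "simple_seq M v \<in> conv.span (range step)" for M and v :: "nat \<Rightarrow> 'k"
      unfolding simple_seq_def by (intro conv.span_sum conv.span_scale conv.span_base) auto
    then show "x \<in> closure (conv.span (range step))"
      unfolding closure_approachable using simple_seq_dense[of UNIV _ x] by (metis closure_UNIV)
  qed
qed (auto simp: separable_conv_seq infinite_dim_conv_seq norm_conv_scale jump_conv_scale jump_step)

section \<open>Extremal vectors in the space c\<close>

definition odds :: "nat \<Rightarrow> nat set" where
  "odds N = (\<lambda>k. 2 * k + 1) ` {..<N}"

lemma mem_odds: "n \<in> odds N \<longleftrightarrow> odd n \<and> n < 2 * N"
  by (auto simp: odds_def elim!: oddE)

lemma finite_odds [simp]: "finite (odds N)"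
  by (simp add: odds_def)

lemma card_odds [simp]: "card (odds N) = N"
  by (simp add: odds_def card_image inj_on_def)

lemma odds_diff_gt: "n \<in> odds (2 * N) - odds N \<Longrightarrow> 2 * N < n"
  by (metis DiffD1 DiffD2 dvd_triv_left linorder_neqE_nat mem_odds)

lemma card_odds_diff: "card (odds (2 * N) - odds N) = N"
  by (subst card_Diff_subset) (auto simp: mem_odds)

text \<open>The sequence 1, -1, 1, -1, ..., constantly 1 from index \<open>2 * N\<close> on. It
  falls by 2 at each index in \<open>odds N\<close>, which will be the greedy set; the competing set
  is formed by the next \<open>N\<close> odd indices.\<close>

definition zigzag :: "nat \<Rightarrow> 'k::real_normed_field conv_seq" where
  "zigzag N = conv_of (\<lambda>m. if m \<in> odds N then -1 else 1)"

lemma seq_of_zigzag: "apply_bcontfun (seq_of (zigzag N)) m = (if m \<in> odds N then -1 else 1)"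
  unfolding zigzag_def by (subst seq_of_conv_of) (auto intro: convergent_eventually_const[of "2 * N"] simp: mem_odds)

lemma norm_zigzag: "norm (zigzag N :: 'k::real_normed_field conv_seq) \<le> 1"
  by (rule norm_conv_seq_le) (simp add: seq_of_zigzag)

lemma jump_zigzag:
  "blinfun_apply (jump n) (zigzag N) = (if n = 0 then 1 else if n > 2 * N then 0 else if odd n then -2 else 2)"
  by (auto simp: jump_apply increment_def seq_of_zigzag mem_odds)

lemma jump_zigzag_odds: "n \<in> odds N \<Longrightarrow> blinfun_apply (jump n) (zigzag N) = -2"
  by (auto simp: jump_zigzag mem_odds odd_pos)

lemma tendsto_jump: "(\<lambda>n. blinfun_apply (jump n) x) \<longlonglongrightarrow> 0"
proof -
  obtain L where L: "apply_bcontfun (seq_of x) \<longlonglongrightarrow> L"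
    using convergent_seq_of[of x] by (auto simp: convergent_def)
  have "(\<lambda>n. apply_bcontfun (seq_of x) (Suc n) - apply_bcontfun (seq_of x) n) \<longlonglongrightarrow> L - L"
    by (intro tendsto_diff LIMSEQ_Suc L)
  then have "(\<lambda>n. blinfun_apply (jump (Suc n)) x) \<longlonglongrightarrow> 0"
    by (simp add: jump_apply increment_def)
  then show ?thesis
    by (rule LIMSEQ_imp_Suc)
qed

text \<open>The triangle inequality is attained: the first \<open>N\<close> steps all equal 1 at
  coordinate \<open>N\<close>.\<close>

lemma super_democracy_step:
  "super_democracy (conv_scale :: 'k::{real_normed_field,euclidean_space} \<Rightarrow> _) step N = real N"
proof (rule antisym)
  interpret sb: seminormalized_complete_biorthogonal_system "conv_scale :: 'k \<Rightarrow> _" step jump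
    by (rule summing_basis)
  show "sb.primal.D N \<le> real N"
  proof (rule sb.primal.super_democracy_least)
    fix A :: "nat set" and \<epsilon> :: "nat \<Rightarrow> 'k"
    assume "finite A" "card A = N" "\<And>j. norm (\<epsilon> j) = 1"
    then show "norm (\<Sum>j\<in>A. conv_scale (\<epsilon> j) (step j)) \<le> real N"
      using sum_norm_le[of A "\<lambda>j. conv_scale (\<epsilon> j) (step j)" "\<lambda>_. 1"]
      by (simp add: norm_conv_scale norm_step)
  qed
  let ?x = "\<Sum>j<N. conv_scale (1 :: 'k) (step j)"
  have "real N = norm (apply_bcontfun (seq_of ?x) N)"
    by simp
  also have "\<dots> \<le> norm ?x"
    by (rule norm_seq_of_le)
  also have "\<dots> \<le> sb.primal.D N"
    using sb.primal.norm_signed_sum_le[of "{..<N}" "\<lambda>_. 1"] by simp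
  finally show "real N \<le> sb.primal.D N" .
qed

text \<open>The triangle inequality is attained again: on \<open>zigzag N\<close>, of norm at most
  1, all the jumps in \<open>odds N\<close> take the value -2.\<close>

lemma D_star_jump:
  "D_star (jump :: nat \<Rightarrow> 'k::{real_normed_field,euclidean_space} conv_seq \<Rightarrow>\<^sub>L 'k) N = 2 * real N"
proof (rule antisym)
  interpret sb: seminormalized_complete_biorthogonal_system "conv_scale :: 'k \<Rightarrow> _" step jump
    by (rule summing_basis)
  show "sb.dual.D N \<le> 2 * real N"
  proof (rule sb.dual.super_democracy_least)
    fix A :: "nat set" and \<epsilon> :: "nat \<Rightarrow> 'k"
    assume "finite A" "card A = N" "\<And>j. norm (\<epsilon> j) = 1"
    then show "norm (\<Sum>j\<in>A. dual_scale (\<epsilon> j) (jump j)) \<le> 2 * real N"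
      using sum_norm_le[of A "\<lambda>j. dual_scale (\<epsilon> j) (jump j)" "\<lambda>_. 2"]
      by (simp add: norm_dual_scale norm_jump_le mult.commute)
  qed
  let ?g = "\<Sum>j\<in>odds N. dual_scale (1 :: 'k) (jump j)"
  have "?g (zigzag N) = (\<Sum>j\<in>odds N. -2)"
    by (simp add: blinfun.sum_left jump_zigzag_odds)
  then have "2 * real N = norm (?g (zigzag N))"
    by (simp add: norm_mult)
  also have "\<dots> \<le> norm ?g * norm (zigzag N :: 'k conv_seq)"
    by (rule norm_blinfun)
  also have "\<dots> \<le> norm ?g"
    by (simp add: mult_left_le norm_zigzag)
  also have "\<dots> \<le> sb.dual.D N"
    using sb.dual.norm_signed_sum_le[of "odds N" "\<lambda>_. 1"] by simp
  finally show "2 * real N \<le> sb.dual.D N" .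
qed

lemma Delta_linear: "1 \<le> j \<Longrightarrow> Delta (\<lambda>n. c * real n) j = c"
  by (cases j) (auto simp: Delta_def algebra_simps)

lemma linear_sequences:
  defines "\<eta> \<equiv> real" and "\<theta> \<equiv> \<lambda>n. 2 * real n"
  shows "concave_seq \<eta>" "concave_seq \<theta>" "S_sum \<eta> \<theta> N = 2 * real N" "T_bar \<eta> \<theta> N = 2 * real N"
proof -
  have \<eta>: "Delta \<eta> j = 1" and \<theta>: "Delta \<theta> j = 2" if "1 \<le> j" for j
    using Delta_linear[OF that, of 1] Delta_linear[OF that, of 2] by (simp_all add: \<eta>_def \<theta>_def)
  show "concave_seq \<eta>" "concave_seq \<theta>"
    by (auto simp: concave_seq_def \<eta> \<theta>)
  show "S_sum \<eta> \<theta> N = 2 * real N"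
    by (simp add: S_sum_def \<eta> \<theta>)
  have "T_sum \<eta> \<theta> N = (\<Sum>j=1..N. 2)" "T_sum \<theta> \<eta> N = (\<Sum>j=1..N. 2)"
    unfolding T_sum_def by (auto intro!: sum.cong simp: \<eta> \<theta>) (auto simp: \<eta>_def \<theta>_def)
  then show "T_bar \<eta> \<theta> N = 2 * real N"
    by (simp add: T_bar_def)
qed

text \<open>Projecting \<open>zigzag N\<close> onto \<open>odds N\<close> removes the upward jumps,
  so the \<open>N\<close> falls by 2 accumulate at coordinate \<open>2 * N\<close>.\<close>

lemma K_const_summing_ge:
  "ereal (2 * real N) \<le> K_const (conv_scale :: 'k::real_normed_field \<Rightarrow> _) step jump N"
proof -
  let ?x = "coord_proj conv_scale step (\<lambda>n. blinfun_apply (jump n)) (odds N) (zigzag N :: 'k conv_seq)"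
  have "apply_bcontfun (seq_of ?x) (2 * N) = (\<Sum>n\<in>odds N. -2)"
    by (auto simp: coord_proj_def jump_zigzag_odds mem_odds intro!: sum.cong)
  then have "2 * real N = norm (apply_bcontfun (seq_of ?x) (2 * N))"
    by (simp add: norm_mult)
  also have "\<dots> \<le> norm ?x"
    by (rule norm_seq_of_le)
  finally have "ereal (2 * real N) \<le> ereal (norm ?x)"
    by simp
  also have "\<dots> \<le> K_const (conv_scale :: 'k \<Rightarrow> _) step jump N"
  proof (rule proj_const_ge)
    have "apply_bcontfun (seq_of (zigzag N :: 'k conv_seq)) (2 * N) \<noteq> apply_bcontfun (seq_of 0) (2 * N)"
      by (simp add: seq_of_zigzag mem_odds)
    then show "zigzag N \<noteq> (0 :: 'k conv_seq)"
      by metis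
  qed (simp_all add: norm_zigzag)
  finally show ?thesis .
qed

lemma jump_perturbed:
  "finite B \<Longrightarrow> blinfun_apply (jump n) (z + (\<Sum>m\<in>B. conv_scale c (step m)))
    = blinfun_apply (jump n) z + (if n \<in> B then c else 0)"
  by (simp add: blinfun.add_right blinfun.sum_right jump_conv_scale jump_step if_distrib[of "(*) c"] cong: if_cong)

text \<open>The perturbation makes the coefficients on the competing set equal to 2. They tie in
  modulus with the -2 on \<open>odds N\<close>, so \<open>odds N\<close> is a greedy set. Removing
  it also cancels the falls, and the remainder grows by \<open>c + 2\<close> for each of the
  \<open>N\<close> pairs of indices.\<close>

lemma summing_greedy:
  fixes c :: real
  assumes "N \<le> M" "M \<le> 2 * N"
    and B: "\<And>n. n \<in> odds (2 * N) - odds N \<Longrightarrow> blinfun_apply (jump n) (zigzag M) + of_real c = (2 :: 'k::real_normed_field)"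
  defines "x \<equiv> zigzag M + (\<Sum>n\<in>odds (2 * N) - odds N. conv_scale (of_real c :: 'k) (step n))"
  shows "greedy_set (\<lambda>n. blinfun_apply (jump n)) x N (odds N)"
    and "1 + (c + 2) * real N
      \<le> norm (x - coord_proj conv_scale step (\<lambda>n. blinfun_apply (jump n)) (odds N) x)"
proof -
  have f: "jump n x = (jump n (zigzag M) + (if n \<in> odds (2 * N) - odds N then of_real c else 0) :: 'k)" for n
    unfolding x_def by (rule jump_perturbed) simp
  have A: "jump n x = (-2 :: 'k)" if "n \<in> odds N" for n
    using that assms(1) unfolding f by (auto simp: jump_zigzag mem_odds odd_pos)
  have le: "norm (jump n x :: 'k) \<le> 2" for n
  proof (cases "n \<in> odds (2 * N) - odds N")
    case True
    then show ?thesis using B[OF True] unfolding f by simp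
  qed (auto simp: f jump_zigzag)
  show "greedy_set (\<lambda>n. blinfun_apply (jump n)) x N (odds N)"
    unfolding greedy_set_def using A le by simp
  let ?y = "x - coord_proj conv_scale step (\<lambda>n. blinfun_apply (jump n)) (odds N) x"
  \<comment> \<open>At coordinate \<open>4 * N\<close> every step involved equals 1, and so does
    \<open>zigzag M\<close> because the index is even.\<close>
  have "apply_bcontfun (seq_of ?y) (4 * N)
      = 1 + (\<Sum>n\<in>odds (2 * N) - odds N. of_real c) - (\<Sum>n\<in>odds N. - 2)"
    unfolding x_def[symmetric] coord_proj_def seq_of_simps seq_of_sum
  proof (intro arg_cong2[of _ _ _ _ "(-)"] sum.cong refl)
    show "apply_bcontfun (seq_of x) (4 * N) = 1 + (\<Sum>n\<in>odds (2 * N) - odds N. of_real c)"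
      unfolding x_def seq_of_simps seq_of_sum
      by (intro arg_cong2[of _ _ _ _ "(+)"] sum.cong) (auto simp: seq_of_zigzag mem_odds)
  qed (auto simp: A mem_odds)
  also have "\<dots> = of_real (1 + (c + 2) * real N)"
    by (simp add: card_odds_diff) (simp add: algebra_simps)
  finally have "norm (apply_bcontfun (seq_of ?y) (4 * N)) = \<bar>1 + (c + 2) * real N\<bar>"
    by (metis norm_of_real)
  then show "1 + (c + 2) * real N \<le> norm ?y"
    using norm_seq_of_le[of ?y "4 * N"] by linarith
qed

text \<open>On the competing set \<open>zigzag (2 * N)\<close> has jumps -2, so \<open>c = 4\<close>
  turns them into 2. Subtracting the perturbation is an approximation by \<open>N\<close> terms that
  leaves a vector of norm at most 1.\<close>

lemma L_const_summing_ge: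
  "ereal (1 + 6 * real N) \<le> L_const (conv_scale :: 'k::real_normed_field \<Rightarrow> _) step jump N"
proof -
  let ?B = "odds (2 * N) - odds N"
  let ?x = "zigzag (2 * N) + (\<Sum>n\<in>?B. conv_scale (of_real 4 :: 'k) (step n))"
  have *: "greedy_set (\<lambda>n. blinfun_apply (jump n)) ?x N (odds N)"
      "1 + (4 + 2) * real N \<le> norm (?x - coord_proj conv_scale step (\<lambda>n. blinfun_apply (jump n)) (odds N) ?x)"
    using summing_greedy[of N "2 * N" 4] by (auto simp: jump_zigzag_odds)
  show ?thesis
    by (rule lebesgue_const_ge[where B = ?B and c = "\<lambda>_. of_real 4" and x = ?x and A = "odds N"])
      (use * in \<open>simp_all add: tendsto_jump card_odds_diff norm_zigzag\<close>)
qed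

text \<open>The competitor must now be a coordinate projection. The jumps of \<open>zigzag N\<close>
  vanish on the competing set, so with \<open>c = 2\<close> the projection of the perturbed vector
  is exactly the perturbation.\<close>

lemma Lt_const_summing_ge:
  "ereal (1 + 4 * real N) \<le> Lt_const (conv_scale :: 'k::real_normed_field \<Rightarrow> _) step jump N"
proof -
  let ?B = "odds (2 * N) - odds N"
  let ?x = "zigzag N + (\<Sum>n\<in>?B. conv_scale (of_real 2 :: 'k) (step n))"
  have zero: "jump n (zigzag N) = (0 :: 'k)" if "n \<in> ?B" for n
    using odds_diff_gt[OF that] by (simp add: jump_zigzag)
  then have *: "greedy_set (\<lambda>n. blinfun_apply (jump n)) ?x N (odds N)"
      "1 + (2 + 2) * real N \<le> norm (?x - coord_proj conv_scale step (\<lambda>n. blinfun_apply (jump n)) (odds N) ?x)"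
    using summing_greedy[of N N 2] by auto
  have "jump n ?x = 2" if "n \<in> ?B" for n
    using that zero[OF that] by (subst jump_perturbed) auto
  then have "coord_proj conv_scale step (\<lambda>n. blinfun_apply (jump n)) ?B ?x = (\<Sum>n\<in>?B. conv_scale (of_real 2) (step n))"
    unfolding coord_proj_def by (intro sum.cong) auto
  then have "norm (?x - coord_proj conv_scale step (\<lambda>n. blinfun_apply (jump n)) ?B ?x) \<le> 1"
    by (simp add: norm_zigzag)
  then show ?thesis
    by (intro proj_lebesgue_const_ge[where B = ?B and x = ?x and A = "odds N"])
      (use * in \<open>simp_all add: tendsto_jump card_odds_diff\<close>)
qed

section \<open>Extremal functionals for the dual system\<close>

definition evaluation :: "nat \<Rightarrow> 'k conv_seq \<Rightarrow>\<^sub>L 'k::real_normed_field" where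
  "evaluation M = (\<Sum>n\<le>M. jump n)"

lemma evaluation_apply: "blinfun_apply (evaluation M) x = apply_bcontfun (seq_of x) M"
  by (simp add: evaluation_def blinfun.sum_left jump_apply sum_increment)

lemma norm_evaluation: "norm (evaluation M) \<le> 1"
  by (rule norm_blinfun_bound) (simp_all add: evaluation_apply norm_seq_of_le)

lemma dual_span_subset: "module.span dual_scale (range es) \<subseteq> dual_closed_span es"
  unfolding dual_closed_span_def by (rule closure_subset)

text \<open>Functionals in the span vanish on all but finitely many steps, and since the steps have
  norm 1, approximation in norm controls all coefficients uniformly. The limit functional, equal to
  1 on every step, shows that this depends on the closed span.\<close>

lemma tendsto_dual_coefficients:
  assumes "g \<in> dual_closed_span (jump :: nat \<Rightarrow> 'k::{real_normed_field,euclidean_space} conv_seq \<Rightarrow>\<^sub>L 'k)"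
  shows "(\<lambda>n. blinfun_apply g (step n)) \<longlonglongrightarrow> 0"
proof (rule LIMSEQ_I)
  interpret sb: seminormalized_complete_biorthogonal_system "conv_scale :: 'k \<Rightarrow> _" step jump
    by (rule summing_basis)
  fix r :: real assume "0 < r"
  then obtain h where h: "h \<in> sb.dual.span (range jump)" "dist h g < r"
    using assms unfolding dual_closed_span_def closure_approachable by blast
  have "sb.dual.span (range jump) \<subseteq> {h. \<exists>M. \<forall>n\<ge>M. blinfun_apply h (step n) = 0}"
  proof (rule sb.dual.span_minimal)
    show "range jump \<subseteq> {h. \<exists>M. \<forall>n\<ge>M. blinfun_apply h (step n) = 0}"
      by (auto simp: jump_step) (metis Suc_n_not_le_n)
    show "sb.dual.subspace {h. \<exists>M. \<forall>n\<ge>M. blinfun_apply h (step n) = 0}"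
    proof (rule sb.dual.subspaceI; clarsimp)
      fix g h :: "'k conv_seq \<Rightarrow>\<^sub>L 'k" and M M'
      assume "\<forall>n\<ge>M. g (step n) = 0" "\<forall>n\<ge>M'. h (step n) = 0"
      then show "\<exists>M. \<forall>n\<ge>M. blinfun_apply (g + h) (step n) = 0"
        by (intro exI[of _ "max M M'"]) (simp add: blinfun.add_left)
    qed blast
  qed
  with h obtain M where M: "\<And>n. n \<ge> M \<Longrightarrow> h (step n) = 0"
    by blast
  have "norm (g (step n) - 0) < r" if "n \<ge> M" for n
  proof -
    have "norm (g (step n) - 0) = norm ((g - h) (step n))"
      using M[OF that] by (simp add: blinfun.diff_left)
    also have "\<dots> \<le> norm (g - h)"
      using norm_blinfun[of "g - h" "step n"] by (simp add: norm_step)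
    finally show ?thesis
      using h(2) by (simp add: dist_norm norm_minus_commute)
  qed
  then show "\<exists>M. \<forall>n\<ge>M. norm (g (step n) - 0) < r"
    by blast
qed

lemma evaluation_perturbed_in_span:
  "evaluation M - (\<Sum>n\<in>B. dual_scale c (jump n))
    \<in> dual_closed_span (jump :: nat \<Rightarrow> 'k::{real_normed_field,euclidean_space} conv_seq \<Rightarrow>\<^sub>L 'k)"
proof -
  interpret sb: seminormalized_complete_biorthogonal_system "conv_scale :: 'k \<Rightarrow> _" step jump
    by (rule summing_basis)
  have "evaluation M - (\<Sum>n\<in>B. dual_scale c (jump n)) \<in> sb.dual.span (range jump)"
    unfolding evaluation_def
    by (intro sb.dual.span_diff sb.dual.span_sum sb.dual.span_scale sb.dual.span_base) auto
  then show ?thesis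
    using dual_span_subset by blast
qed

lemma evaluation_perturbed_step:
  "finite B \<Longrightarrow> blinfun_apply (evaluation M - (\<Sum>n\<in>B. dual_scale c (jump n))) (step m)
    = (if m \<le> M then 1 else 0) - (if m \<in> B then c else 0)"
  by (simp add: blinfun.diff_left blinfun.sum_left evaluation_apply jump_step if_distrib[of "(*) c"] cong: if_cong)

text \<open>All coefficients of the evaluation up to \<open>2 * N\<close> are 1, so its projection
  onto \<open>odds N\<close> is the sum of the odd jumps, which is tested on
  \<open>zigzag N\<close>.\<close>

lemma K_star_summing_ge:
  "ereal (2 * real N) \<le> K_star step (jump :: nat \<Rightarrow> 'k::{real_normed_field,euclidean_space} conv_seq \<Rightarrow>\<^sub>L 'k) N"
proof -
  let ?e = "evaluation (2 * N) :: 'k conv_seq \<Rightarrow>\<^sub>L 'k"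
  let ?g = "coord_proj dual_scale jump (\<lambda>n g. blinfun_apply g (step n)) (odds N) ?e"
  have "?g (zigzag N) = (\<Sum>n\<in>odds N. -2)"
    unfolding coord_proj_def blinfun.sum_left
    by (rule sum.cong) (auto simp: evaluation_apply jump_zigzag_odds mem_odds)
  then have "2 * real N = norm (?g (zigzag N))"
    by (simp add: norm_mult)
  also have "\<dots> \<le> norm ?g * norm (zigzag N :: 'k conv_seq)"
    by (rule norm_blinfun)
  also have "\<dots> \<le> norm ?g"
    by (simp add: mult_left_le norm_zigzag)
  finally have "ereal (2 * real N) \<le> ereal (norm ?g)"
    by simp
  also have "\<dots> \<le> K_star step (jump :: nat \<Rightarrow> 'k conv_seq \<Rightarrow>\<^sub>L 'k) N"
  proof (rule proj_const_ge)
    show "?e \<in> dual_closed_span jump"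
      using evaluation_perturbed_in_span[of "2 * N" _ "{}"] by simp
    have "?e (step 0) \<noteq> 0"
      by (simp add: evaluation_apply)
    then show "?e \<noteq> 0"
      by (metis blinfun.zero_left)
  qed (simp_all add: norm_evaluation)
  finally show ?thesis .
qed

text \<open>The coefficients are 1 on \<open>odds N\<close> and -1 on the competing set, with
  modulus at most 1 elsewhere. Tested on \<open>zigzag (2 * N)\<close>, the evaluation gives 1
  because \<open>M\<close> is even, the competing set contributes \<open>2 * c * N\<close>, and
  removing the greedy part adds \<open>2 * N\<close>.\<close>

lemma dual_summing_greedy:
  fixes c :: real
  assumes "even M" "2 * N \<le> M"
    and B: "\<And>n. n \<in> odds (2 * N) - odds N \<Longrightarrow> (if n \<le> M then 1 else 0) - of_real c = (-1 :: 'k::{real_normed_field,euclidean_space})"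
  defines "x \<equiv> evaluation M - (\<Sum>n\<in>odds (2 * N) - odds N. dual_scale (of_real c :: 'k) (jump n))"
  shows "greedy_set (\<lambda>n g. blinfun_apply g (step n)) x N (odds N)"
    and "1 + 2 * (c + 1) * real N
      \<le> norm (x - coord_proj dual_scale jump (\<lambda>n g. blinfun_apply g (step n)) (odds N) x)"
proof -
  have f: "x (step n) = (if n \<le> M then 1 else 0) - (if n \<in> odds (2 * N) - odds N then of_real c else 0)" for n
    unfolding x_def by (rule evaluation_perturbed_step) simp
  have A: "x (step n) = 1" if "n \<in> odds N" for n
    using that assms(2) unfolding f by (auto simp: mem_odds)
  have le: "norm (x (step n)) \<le> 1" for n
  proof (cases "n \<in> odds (2 * N) - odds N")
    case True
    then show ?thesis using B[OF True] unfolding f by simp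
  qed (auto simp: f)
  show "greedy_set (\<lambda>n g. blinfun_apply g (step n)) x N (odds N)"
    unfolding greedy_set_def using A le by simp
  let ?y = "x - coord_proj dual_scale jump (\<lambda>n g. blinfun_apply g (step n)) (odds N) x"
  let ?z = "zigzag (2 * N) :: 'k conv_seq"
  have "?y ?z = 1 - (\<Sum>n\<in>odds (2 * N) - odds N. of_real c * -2) - (\<Sum>n\<in>odds N. -2)"
    unfolding coord_proj_def blinfun.diff_left blinfun.sum_left
  proof (intro arg_cong2[of _ _ _ _ "(-)"] sum.cong refl)
    show "x ?z = 1 - (\<Sum>n\<in>odds (2 * N) - odds N. of_real c * -2)"
      unfolding x_def blinfun.diff_left blinfun.sum_left
      by (intro arg_cong2[of _ _ _ _ "(-)"] sum.cong)
        (use \<open>even M\<close> in \<open>auto simp: evaluation_apply seq_of_zigzag mem_odds jump_zigzag_odds\<close>)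
  next
    fix n assume "n \<in> odds N"
    then have "n \<in> odds (2 * N)"
      by (auto simp: mem_odds)
    then show "blinfun_apply (dual_scale (x (step n)) (jump n)) ?z = - 2"
      using A[OF \<open>n \<in> odds N\<close>] by (simp add: jump_zigzag_odds)
  qed
  also have "\<dots> = of_real (1 + 2 * (c + 1) * real N)"
    by (simp add: card_odds_diff) (simp add: algebra_simps)
  finally have "\<bar>1 + 2 * (c + 1) * real N\<bar> = norm (?y ?z)"
    by (metis norm_of_real)
  also have "\<dots> \<le> norm ?y * norm ?z"
    by (rule norm_blinfun)
  also have "\<dots> \<le> norm ?y"
    by (simp add: mult_left_le norm_zigzag)
  finally show "1 + 2 * (c + 1) * real N \<le> norm ?y"
    by linarith
qed

text \<open>For \<open>M = 4 * N\<close> the competing set lies below \<open>M\<close>, so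
  \<open>c = 2\<close> turns its coefficients 1 into -1. Undoing the perturbation restores the
  evaluation, of norm at most 1.\<close>

lemma L_star_summing_ge:
  "ereal (1 + 6 * real N) \<le> L_star step (jump :: nat \<Rightarrow> 'k::{real_normed_field,euclidean_space} conv_seq \<Rightarrow>\<^sub>L 'k) N"
proof -
  let ?B = "odds (2 * N) - odds N"
  let ?x = "evaluation (4 * N) - (\<Sum>n\<in>?B. dual_scale (of_real 2 :: 'k) (jump n))"
  have *: "greedy_set (\<lambda>n g. blinfun_apply g (step n)) ?x N (odds N)"
      "1 + 2 * (2 + 1) * real N \<le> norm (?x - coord_proj dual_scale jump (\<lambda>n g. blinfun_apply g (step n)) (odds N) ?x)"
    by (rule dual_summing_greedy; auto simp: mem_odds)+
  have "?x - (\<Sum>n\<in>?B. dual_scale (of_real (-2)) (jump n)) = evaluation (4 * N)"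
    by (rule blinfun_eqI) (simp add: blinfun.diff_left blinfun.sum_left sum_negf)
  then have "norm (?x - (\<Sum>n\<in>?B. dual_scale (of_real (-2)) (jump n))) \<le> 1"
    by (simp only: norm_evaluation)
  then show ?thesis
    by (intro lebesgue_const_ge[where B = ?B and c = "\<lambda>_. of_real (-2)" and x = ?x and A = "odds N"])
      (use * in \<open>simp_all add: tendsto_dual_coefficients evaluation_perturbed_in_span card_odds_diff norm_evaluation\<close>)
qed

text \<open>For \<open>M = 2 * N\<close> the competing set lies above \<open>M\<close>, where the
  evaluation has coefficients 0. With \<open>c = 1\<close> the coordinate projection is therefore
  exactly the perturbation.\<close>

lemma Lt_star_summing_ge:
  "ereal (1 + 4 * real N) \<le> Lt_star step (jump :: nat \<Rightarrow> 'k::{real_normed_field,euclidean_space} conv_seq \<Rightarrow>\<^sub>L 'k) N"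
proof -
  let ?B = "odds (2 * N) - odds N"
  let ?x = "evaluation (2 * N) - (\<Sum>n\<in>?B. dual_scale (of_real 1 :: 'k) (jump n))"
  have above: "\<not> n \<le> 2 * N" if "n \<in> ?B" for n
    using odds_diff_gt[OF that] by simp
  have *: "greedy_set (\<lambda>n g. blinfun_apply g (step n)) ?x N (odds N)"
      "1 + 2 * (1 + 1) * real N \<le> norm (?x - coord_proj dual_scale jump (\<lambda>n g. blinfun_apply g (step n)) (odds N) ?x)"
    by (rule dual_summing_greedy; use above in simp)+
  have "?x (step n) = -1" if "n \<in> ?B" for n
    using that above[OF that] by (subst evaluation_perturbed_step) auto
  then have "coord_proj dual_scale jump (\<lambda>n g. blinfun_apply g (step n)) ?B ?x = (\<Sum>n\<in>?B. dual_scale (-1) (jump n))"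
    unfolding coord_proj_def by (intro sum.cong) auto
  also have "\<dots> = - (\<Sum>n\<in>?B. dual_scale (of_real 1) (jump n))"
    by (rule blinfun_eqI) (simp add: blinfun.minus_left blinfun.sum_left sum_negf)
  finally have "?x - coord_proj dual_scale jump (\<lambda>n g. blinfun_apply g (step n)) ?B ?x = evaluation (2 * N)"
    by simp
  then have "norm (?x - coord_proj dual_scale jump (\<lambda>n g. blinfun_apply g (step n)) ?B ?x) \<le> 1"
    by (simp only: norm_evaluation)
  then show ?thesis
    by (intro proj_lebesgue_const_ge[where B = ?B and x = ?x and A = "odds N"])
      (use * in \<open>simp_all add: tendsto_dual_coefficients evaluation_perturbed_in_span card_odds_diff norm_evaluation\<close>)
qed

section \<open>Exact constants of the summing basis, and the theorem\<close>

lemma summing_basis_constants: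
  fixes N :: nat
  shows "K_const (conv_scale :: 'k::{real_normed_field,euclidean_space} \<Rightarrow> _) step jump N = ereal (2 * real N)"
    "L_const (conv_scale :: 'k \<Rightarrow> _) step jump N = ereal (1 + 6 * real N)"
    "Lt_const (conv_scale :: 'k \<Rightarrow> _) step jump N = ereal (1 + 4 * real N)"
    "K_star step (jump :: nat \<Rightarrow> 'k conv_seq \<Rightarrow>\<^sub>L 'k) N = ereal (2 * real N)"
    "L_star step (jump :: nat \<Rightarrow> 'k conv_seq \<Rightarrow>\<^sub>L 'k) N = ereal (1 + 6 * real N)"
    "Lt_star step (jump :: nat \<Rightarrow> 'k conv_seq \<Rightarrow>\<^sub>L 'k) N = ereal (1 + 4 * real N)"
proof -
  interpret sb: seminormalized_complete_biorthogonal_system "conv_scale :: 'k \<Rightarrow> _" step jump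
    by (rule summing_basis)
  have D: "sb.primal.D = real" "sb.dual.D = (\<lambda>n. 2 * real n)"
    by (simp_all add: fun_eq_iff super_democracy_step D_star_jump)
  \<comment> \<open>The upper bound for \<open>K_star\<close> comes from the estimates for concave
    \<open>D_star\<close>; the other five are among those with \<open>T_bar\<close>.\<close>
  note upper = sb.T_bar_estimates[of N] sb.S_sum_estimates(2)[of N]
  note upper = upper[unfolded D linear_sequences(3,4)]
  show "K_const (conv_scale :: 'k \<Rightarrow> _) step jump N = ereal (2 * real N)"
    "L_const (conv_scale :: 'k \<Rightarrow> _) step jump N = ereal (1 + 6 * real N)"
    "Lt_const (conv_scale :: 'k \<Rightarrow> _) step jump N = ereal (1 + 4 * real N)"
    "K_star step (jump :: nat \<Rightarrow> 'k conv_seq \<Rightarrow>\<^sub>L 'k) N = ereal (2 * real N)"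
    "L_star step (jump :: nat \<Rightarrow> 'k conv_seq \<Rightarrow>\<^sub>L 'k) N = ereal (1 + 6 * real N)"
    "Lt_star step (jump :: nat \<Rightarrow> 'k conv_seq \<Rightarrow>\<^sub>L 'k) N = ereal (1 + 4 * real N)"
    using upper linear_sequences(2)
      K_const_summing_ge[of N, where 'k='k] L_const_summing_ge[of N, where 'k='k] Lt_const_summing_ge[of N, where 'k='k]
      K_star_summing_ge[of N, where 'k='k] L_star_summing_ge[of N, where 'k='k] Lt_star_summing_ge[of N, where 'k='k]
    by (auto intro: antisym)
qed

lemma summing_basis_sharp:
  fixes smul :: "'k::{real_normed_field,euclidean_space} \<Rightarrow> 'k conv_seq \<Rightarrow> 'k conv_seq"
  defines "smul \<equiv> conv_scale"
  shows "let D = super_democracy smul step;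
           Ds = D_star (jump :: nat \<Rightarrow> 'k conv_seq \<Rightarrow>\<^sub>L 'k);
           T = T_bar D Ds;
           S = S_sum D Ds
       in
        concave_seq D \<and> concave_seq Ds \<and>
        (\<forall>N\<ge>1.
            K_const smul step jump N = ereal (T N) \<and>
            L_const smul step jump N = ereal (1 + 3 * T N) \<and>
            L_star step (jump :: nat \<Rightarrow> 'k conv_seq \<Rightarrow>\<^sub>L 'k) N = ereal (1 + 3 * T N) \<and>
            Lt_const smul step jump N = ereal (1 + 2 * T N) \<and>
            Lt_star step (jump :: nat \<Rightarrow> 'k conv_seq \<Rightarrow>\<^sub>L 'k) N = ereal (1 + 2 * T N) \<and>
            S N = T N \<and>
            K_const smul step jump N = ereal (S N) \<and>
            L_const smul step jump N = ereal (1 + 3 * S N) \<and>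
            Lt_const smul step jump N = ereal (1 + 2 * S N) \<and>
            K_star step (jump :: nat \<Rightarrow> 'k conv_seq \<Rightarrow>\<^sub>L 'k) N = ereal (S N) \<and>
            L_star step (jump :: nat \<Rightarrow> 'k conv_seq \<Rightarrow>\<^sub>L 'k) N = ereal (1 + 3 * S N) \<and>
            Lt_star step (jump :: nat \<Rightarrow> 'k conv_seq \<Rightarrow>\<^sub>L 'k) N = ereal (1 + 2 * S N))"
proof -
  have D: "super_democracy (conv_scale :: 'k \<Rightarrow> _) step = real" "D_star (jump :: nat \<Rightarrow> 'k conv_seq \<Rightarrow>\<^sub>L 'k) = (\<lambda>n. 2 * real n)"
    by (simp_all add: fun_eq_iff super_democracy_step D_star_jump)
  show ?thesis
    by (simp add: D Let_def linear_sequences summing_basis_constants smul_def)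
qed

theorem theorem1p1:
  shows "(\<forall>(smul :: 'k::{real_normed_field,euclidean_space} \<Rightarrow> 'a::banach \<Rightarrow> 'a) e (es :: nat \<Rightarrow> 'a \<Rightarrow>\<^sub>L 'k).
      seminormalized_complete_biorthogonal_system smul e es \<longrightarrow>
      (let D = super_democracy smul e;
           Ds = D_star es;
           T = T_bar D Ds;
           S = S_sum D Ds
       in
        (\<forall>N\<ge>1.
            K_const smul e es N \<le> ereal (T N) \<and>
            L_const smul e es N \<le> ereal (1 + 3 * T N) \<and>
            L_star e es N \<le> ereal (1 + 3 * T N) \<and>
            Lt_const smul e es N \<le> ereal (1 + 2 * T N) \<and>
            Lt_star e es N \<le> ereal (1 + 2 * T N)) \<and>
        (concave_seq D \<longrightarrow>
          (\<forall>N\<ge>1.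
            S N \<le> T N \<and>
            K_const smul e es N \<le> ereal (S N) \<and>
            L_const smul e es N \<le> ereal (1 + 3 * S N) \<and>
            Lt_const smul e es N \<le> ereal (1 + 2 * S N))) \<and>
        (concave_seq Ds \<longrightarrow>
          (\<forall>N\<ge>1.
            S N \<le> T N \<and>
            K_star e es N \<le> ereal (S N) \<and>
            L_star e es N \<le> ereal (1 + 3 * S N) \<and>
            Lt_star e es N \<le> ereal (1 + 2 * S N)))))
    \<and>
    (\<exists>(smul :: 'k \<Rightarrow> 'k conv_seq \<Rightarrow> 'k conv_seq) e (es :: nat \<Rightarrow> 'k conv_seq \<Rightarrow>\<^sub>L 'k).
      seminormalized_complete_biorthogonal_system smul e es \<and>
      (let D = super_democracy smul e;
           Ds = D_star es;
           T = T_bar D Ds;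
           S = S_sum D Ds
       in
        concave_seq D \<and> concave_seq Ds \<and>
        (\<forall>N\<ge>1.
            K_const smul e es N = ereal (T N) \<and>
            L_const smul e es N = ereal (1 + 3 * T N) \<and>
            L_star e es N = ereal (1 + 3 * T N) \<and>
            Lt_const smul e es N = ereal (1 + 2 * T N) \<and>
            Lt_star e es N = ereal (1 + 2 * T N) \<and>
            S N = T N \<and>
            K_const smul e es N = ereal (S N) \<and>
            L_const smul e es N = ereal (1 + 3 * S N) \<and>
            Lt_const smul e es N = ereal (1 + 2 * S N) \<and>
            K_star e es N = ereal (S N) \<and>
            L_star e es N = ereal (1 + 3 * S N) \<and>
            Lt_star e es N = ereal (1 + 2 * S N))))"
proof (intro conjI, goal_cases)
  case 1
  show ?case
  proof (intro allI impI)
    fix smul :: "'k \<Rightarrow> 'a \<Rightarrow> 'a" and e and es :: "nat \<Rightarrow> 'a \<Rightarrow>\<^sub>L 'k"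
    assume "seminormalized_complete_biorthogonal_system smul e es"
    then interpret seminormalized_complete_biorthogonal_system smul e es .
    show "(let D = super_democracy smul e;
            Ds = D_star es;
            T = T_bar D Ds;
            S = S_sum D Ds
        in
         (\<forall>N\<ge>1.
             K_const smul e es N \<le> ereal (T N) \<and>
             L_const smul e es N \<le> ereal (1 + 3 * T N) \<and>
             L_star e es N \<le> ereal (1 + 3 * T N) \<and>
             Lt_const smul e es N \<le> ereal (1 + 2 * T N) \<and>
             Lt_star e es N \<le> ereal (1 + 2 * T N)) \<and>
         (concave_seq D \<longrightarrow>
           (\<forall>N\<ge>1.
             S N \<le> T N \<and>
             K_const smul e es N \<le> ereal (S N) \<and>
             L_const smul e es N \<le> ereal (1 + 3 * S N) \<and>
             Lt_const smul e es N \<le> ereal (1 + 2 * S N))) \<and>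
         (concave_seq Ds \<longrightarrow>
           (\<forall>N\<ge>1.
             S N \<le> T N \<and>
             K_star e es N \<le> ereal (S N) \<and>
             L_star e es N \<le> ereal (1 + 3 * S N) \<and>
             Lt_star e es N \<le> ereal (1 + 2 * S N))))"
      unfolding Let_def using T_bar_estimates S_sum_estimates by simp
  qed
next
  case 2
  show ?case
    by (intro exI[of _ conv_scale] exI[of _ step] exI[of _ jump] conjI summing_basis summing_basis_sharp)
qed

end
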